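(* Let $\Omega\subset\mathbb{C}^n$ be a smooth bounded strongly convex domain. Let $\phi=(\phi_1,\dots,\phi_n):\Omega\to\Omega$ be a holomorphic self-map such that each $\phi_j$, $j=1,\dots,n$, is holomorphic on a neighbourhood of $\overline{\Omega}$. If the composition operator $C_\phi$ is compact on $A^2(\Omega)$, then $b\Omega\cap b\phi(\overline{\Omega})$ is nowhere dense in $b\Omega$.
   Context: For a set $S\subset\mathbb{C}^n$, $bS$ denotes its topological boundary; thus $b\phi(\overline\Omega)$ is the boundary of the set $\phi(\overline\Omega)$. $A^2(\Omega)$ is the Bergman space of holomorphic $f:\Omega\to\mathbb{C}$ with $\int_\Omega|f|^2\,dV<\infty$ ($V$ Lebesgue volume measure), with norm $\|f\|=(\int_\Omega|f|^2dV)^{1/2}$. For a holomorphic self-map $\phi:\Omega\to\Omega$, $C_\phi(f)=f\circ\phi$. *)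

theory Defs
  imports "HOL-Analysis.Analysis"
begin

section \<open>Smooth bounded strongly convex domains\<close>

text \<open>Meant for open \<open>S\<close>, where Frechet derivatives are unique.\<close>

fun Ck_on :: "nat \<Rightarrow> ('a::euclidean_space) set \<Rightarrow> ('a \<Rightarrow> real) \<Rightarrow> bool" where
  "Ck_on 0 S f \<longleftrightarrow> continuous_on S f"
| "Ck_on (Suc k) S f \<longleftrightarrow>
     (\<forall>x\<in>S. f differentiable (at x)) \<and>
     (\<forall>v. Ck_on k S (\<lambda>x. frechet_derivative f (at x) v))"

definition smooth_on :: "('a::euclidean_space) set \<Rightarrow> ('a \<Rightarrow> real) \<Rightarrow> bool" where
  "smooth_on S f \<longleftrightarrow> (\<forall>k. Ck_on k S f)"

definition smooth_defining_function ::
    "('a::euclidean_space) set \<Rightarrow> 'a set \<Rightarrow> ('a \<Rightarrow> real) \<Rightarrow> bool" where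
  "smooth_defining_function \<Omega> U \<rho> \<longleftrightarrow>
     open U \<and> frontier \<Omega> \<subseteq> U \<and> smooth_on U \<rho> \<and>
     \<Omega> \<inter> U = {x \<in> U. \<rho> x < 0} \<and>
     (\<forall>p \<in> frontier \<Omega>. \<exists>v. frechet_derivative \<rho> (at p) v \<noteq> 0)"

definition hessian_form :: "('a::euclidean_space \<Rightarrow> real) \<Rightarrow> 'a \<Rightarrow> 'a \<Rightarrow> 'a \<Rightarrow> real" where
  "hessian_form \<rho> p v w = frechet_derivative (\<lambda>x. frechet_derivative \<rho> (at x) v) (at p) w"

text \<open>The real Hessian is required to be positive definite on the real tangent space
  \<open>ker d\<rho>(p)\<close> of the boundary; this does not depend on the choice of the defining function.
  Convexity is listed explicitly, although it follows from the other conditions (real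
  dimension at least two).\<close>

definition smooth_bounded_strongly_convex_domain :: "('a::euclidean_space) set \<Rightarrow> bool" where
  "smooth_bounded_strongly_convex_domain \<Omega> \<longleftrightarrow>
     open \<Omega> \<and> connected \<Omega> \<and> \<Omega> \<noteq> {} \<and> bounded \<Omega> \<and> convex \<Omega> \<and>
     (\<exists>U \<rho>. smooth_defining_function \<Omega> U \<rho> \<and>
        (\<forall>p \<in> frontier \<Omega>. \<forall>v. v \<noteq> 0 \<and> frechet_derivative \<rho> (at p) v = 0
            \<longrightarrow> hessian_form \<rho> p v v > 0))"

section \<open>Holomorphic functions of several variables\<close>

text \<open>The derivative over the reals exists and is complex linear; \<open>(*s)\<close> is
  multiplication of a vector by a complex scalar. Meant for open \<open>S\<close>.\<close>

definition cn_holomorphic_on :: "(complex^'n \<Rightarrow> complex) \<Rightarrow> (complex^'n) set \<Rightarrow> bool" where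
  "cn_holomorphic_on f S \<longleftrightarrow>
     (\<forall>z\<in>S. \<exists>D. (f has_derivative D) (at z) \<and> (\<forall>c v. D (c *s v) = c * D v))"

definition holomorphic_self_map :: "(complex^'n) set \<Rightarrow> (complex^'n \<Rightarrow> complex^'n) \<Rightarrow> bool" where
  "holomorphic_self_map \<Omega> \<phi> \<longleftrightarrow>
     \<phi> ` \<Omega> \<subseteq> \<Omega> \<and> (\<forall>j. cn_holomorphic_on (\<lambda>z. \<phi> z $ j) \<Omega>)"

section \<open>The Bergman space and compact operators on it\<close>

text \<open>Elements are represented by total functions whose values outside \<open>\<Omega>\<close> are
  irrelevant, so \<open>bergman_norm \<Omega>\<close> is only a seminorm on representatives.\<close>

definition bergman_space :: "(complex^'n) set \<Rightarrow> (complex^'n \<Rightarrow> complex) set" where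
  "bergman_space \<Omega> =
     {f. cn_holomorphic_on f \<Omega> \<and> set_integrable lborel \<Omega> (\<lambda>z. (cmod (f z))\<^sup>2)}"

definition bergman_norm :: "(complex^'n) set \<Rightarrow> (complex^'n \<Rightarrow> complex) \<Rightarrow> real" where
  "bergman_norm \<Omega> f = sqrt (set_lebesgue_integral lborel \<Omega> (\<lambda>z. (cmod (f z))\<^sup>2))"

definition composition_operator ::
    "(complex^'n \<Rightarrow> complex^'n) \<Rightarrow> (complex^'n \<Rightarrow> complex) \<Rightarrow> (complex^'n \<Rightarrow> complex)" where
  "composition_operator \<phi> f = f \<circ> \<phi>"

text \<open>An operator is compact if it maps the space to itself and sends every bounded sequence
  to one with a norm convergent subsequence. The self-map condition cannot be dropped:
  for \<open>n > 1\<close> a composition operator need not preserve the Bergman space.\<close>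

definition compact_on_bergman_space ::
    "(complex^'n) set \<Rightarrow> ((complex^'n \<Rightarrow> complex) \<Rightarrow> (complex^'n \<Rightarrow> complex)) \<Rightarrow> bool" where
  "compact_on_bergman_space \<Omega> T \<longleftrightarrow>
     T ` bergman_space \<Omega> \<subseteq> bergman_space \<Omega> \<and>
     (\<forall>F. range F \<subseteq> bergman_space \<Omega> \<and> bounded (range (\<lambda>k. bergman_norm \<Omega> (F k))) \<longrightarrow>
        (\<exists>g \<in> bergman_space \<Omega>. \<exists>r :: nat \<Rightarrow> nat. strict_mono r \<and>
           (\<lambda>k. bergman_norm \<Omega> (\<lambda>z. T (F (r k)) z - g z)) \<longlonglongrightarrow> 0))"

section \<open>Nowhere dense subsets\<close>

definition nowhere_dense_in :: "'a topology \<Rightarrow> 'a set \<Rightarrow> bool" where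
  "nowhere_dense_in X S \<longleftrightarrow> S \<subseteq> topspace X \<and> X interior_of (X closure_of S) = {}"

end

theory Submission
  imports Defs "HOL-Complex_Analysis.Cauchy_Integral_Formula"
begin

text \<open>
  In fact \<open>\<phi>(p)\<close> never lies on the boundary when \<open>C\<^sub>\<phi>\<close> is compact, so the intersection
  in question is empty. Suppose \<open>p\<close> and \<open>q = \<phi>(p)\<close> are boundary points, with inner unit normals \<open>\<mu>\<close>
  and \<open>\<nu>\<close>. Strong convexity gives \<open>\<nu> \<bullet> (w - q) \<ge> c \<bar>w - q\<bar>\<^sup>2\<close> on \<open>\<Omega>\<close>. Let \<open>l\<close> be the complex affine
  function with real part \<open>\<nu> \<bullet> (w - q)\<close>, \<open>d\<close> the real dimension, and
  \<open>f\<^sub>x = x\<^bsup>(d+1)/2\<^esup> exp(-x\<^sup>2 l)\<close>. The square norm of \<open>f\<^sub>x\<close> is governed by the volume of the cap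
  \<open>\<nu> \<bullet> (w - q) \<le> x\<^sup>-\<^sup>2\<close>, which is of order \<open>x\<^bsup>-(d+1)\<^esup>\<close>, so the \<open>f\<^sub>x\<close> are bounded in norm.
  The function \<open>u = Re (l \<circ> \<phi>)\<close> is nonnegative on \<open>\<Omega>\<close> and vanishes at \<open>p\<close>, so its
  differential there is a multiple of \<open>\<mu>\<close>, and \<open>u\<close> is at most of order \<open>x\<^sup>-\<^sup>2\<close> on a cap of comparable
  volume at \<open>p\<close>. Hence \<open>\<parallel>f\<^sub>x \<circ> \<phi>\<parallel>\<close> stays bounded below, while \<open>f\<^sub>x \<circ> \<phi> \<rightarrow> 0\<close> pointwise on
  \<open>\<Omega>\<close>, which leaves \<open>0\<close> as the only possible norm limit.
\<close>

section \<open>Boundary geometry of strongly convex domains\<close>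

lemma linear_expand_Basis:
  fixes L :: "'a::euclidean_space \<Rightarrow> real"
  assumes "linear L"
  shows "L v = (\<Sum>b\<in>Basis. (v \<bullet> b) * L b)"
proof -
  have "L v = L (\<Sum>b\<in>Basis. (v \<bullet> b) *\<^sub>R b)" by (simp add: euclidean_representation)
  also have "\<dots> = (\<Sum>b\<in>Basis. (v \<bullet> b) * L b)"
    using assms by (simp add: linear_sum linear_cmul)
  finally show ?thesis .
qed

lemma smooth_on_C2:
  fixes \<rho> :: "'a::euclidean_space \<Rightarrow> real"
  assumes "smooth_on U \<rho>" "x \<in> U"
  shows "\<rho> differentiable (at x)" "(\<lambda>y. frechet_derivative \<rho> (at y) v) differentiable (at x)"
proof -
  have "Ck_on (Suc (Suc 0)) U \<rho>" using assms(1) unfolding smooth_on_def by blast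
  then have d: "\<rho> differentiable (at x)"
    and "Ck_on (Suc 0) U (\<lambda>y. frechet_derivative \<rho> (at y) v)"
    using assms(2) by (auto simp: Ck_on.simps)
  then show "\<rho> differentiable (at x)" "(\<lambda>y. frechet_derivative \<rho> (at y) v) differentiable (at x)"
    using assms(2) by (auto simp: Ck_on.simps)
qed

lemma hessian_form_has_derivative:
  fixes \<rho> :: "'a::euclidean_space \<Rightarrow> real"
  assumes "smooth_on U \<rho>" "x \<in> U"
  shows "((\<lambda>y. frechet_derivative \<rho> (at y) v) has_derivative hessian_form \<rho> x v) (at x)"
  using smooth_on_C2(2)[OF assms, of v]
  by (simp add: frechet_derivative_works hessian_form_def[abs_def])

lemma linear_gradient:
  fixes \<rho> :: "'a::euclidean_space \<Rightarrow> real"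
  assumes "smooth_on U \<rho>" "x \<in> U"
  shows "linear (frechet_derivative \<rho> (at x))"
  using smooth_on_C2(1)[OF assms] by (rule linear_frechet_derivative)

text \<open>Linearity in the last argument is that of a derivative. For linearity in
  \<open>v\<close>, expand \<open>v\<close> in the basis inside the gradient, which is linear at
  every point of \<open>U\<close>, then differentiate and use uniqueness of derivatives.\<close>

lemma bilinear_hessian_form:
  fixes \<rho> :: "'a::euclidean_space \<Rightarrow> real"
  assumes U: "open U" and sm: "smooth_on U \<rho>" and x: "x \<in> U"
  shows "bilinear (hessian_form \<rho> x)"
proof -
  note der = hessian_form_has_derivative[OF sm x]
  have lin2: "linear (hessian_form \<rho> x v)" for v
    using der[of v] has_derivative_linear by blast
  have "hessian_form \<rho> x v = (\<lambda>w. \<Sum>b\<in>Basis. (v \<bullet> b) * hessian_form \<rho> x b w)" for v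
  proof -
    have "((\<lambda>y. \<Sum>b\<in>Basis. (v \<bullet> b) * frechet_derivative \<rho> (at y) b)
        has_derivative (\<lambda>w. \<Sum>b\<in>Basis. (v \<bullet> b) * hessian_form \<rho> x b w)) (at x)"
      by (auto intro!: derivative_eq_intros der)
    then have "((\<lambda>y. frechet_derivative \<rho> (at y) v)
        has_derivative (\<lambda>w. \<Sum>b\<in>Basis. (v \<bullet> b) * hessian_form \<rho> x b w)) (at x)"
      by (rule has_derivative_transform_within_open[OF _ U x])
         (rule linear_expand_Basis[OF linear_gradient[OF sm], symmetric])
    then show ?thesis using der[of v] has_derivative_unique by blast
  qed
  then have eq: "hessian_form \<rho> x v w = (\<Sum>b\<in>Basis. (v \<bullet> b) * hessian_form \<rho> x b w)" for v w
    by metis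
  have "linear (\<lambda>v. hessian_form \<rho> x v w)" for w
    by (rule linearI; subst (1 2) eq)
       (auto simp: eq[of "_ + _"] eq[of "_ *\<^sub>R _"] inner_add_left algebra_simps sum.distrib sum_distrib_left
          simp del: eq)
  with lin2 show ?thesis by (simp add: bilinear_def)
qed

text \<open>The mean value theorem along the segment from \<open>x\<close> to \<open>x + v\<close>
  turns the first-order error of the gradient at \<open>x\<close> into a second-order error of
  \<rho>.\<close>

lemma second_order_Taylor:
  fixes \<rho> :: "'a::euclidean_space \<Rightarrow> real"
  assumes U: "open U" and sm: "smooth_on U \<rho>" and x: "x \<in> U" and "\<eta> > 0"
  obtains \<delta> where "\<delta> > 0"
    "\<And>v. norm v < \<delta> \<Longrightarrow>
       \<bar>\<rho> (x + v) - \<rho> x - frechet_derivative \<rho> (at x) v - hessian_form \<rho> x v v / 2\<bar> \<le> \<eta> * (norm v)\<^sup>2"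
proof -
  let ?D = "\<lambda>y. frechet_derivative \<rho> (at y)" and ?H = "hessian_form \<rho> x"
  \<comment> \<open>The errors of the partial derivatives add up over the basis, so each gets an
    equal share of \<eta>.\<close>
  define e where "e = \<eta> / DIM('a)"
  have e: "e > 0" using \<open>\<eta> > 0\<close> by (simp add: e_def)
  have "\<exists>\<delta>>0. \<forall>y. norm (y - x) < \<delta> \<longrightarrow> \<bar>?D y b - ?D x b - ?H b (y - x)\<bar> \<le> e * norm (y - x)" for b
    using hessian_form_has_derivative[OF sm x, of b] e unfolding has_derivative_at_alt by auto
  then obtain d where d: "\<And>b. d b > 0"
    "\<And>b y. norm (y - x) < d b \<Longrightarrow> \<bar>?D y b - ?D x b - ?H b (y - x)\<bar> \<le> e * norm (y - x)"
    by metis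
  obtain r where r: "r > 0" "ball x r \<subseteq> U" using U x openE by blast
  define \<delta> where "\<delta> = Min (insert r (d ` Basis))"
  have \<delta>: "\<delta> > 0" "\<delta> \<le> r" "\<And>b. b \<in> Basis \<Longrightarrow> \<delta> \<le> d b"
    using d(1) r(1) by (auto simp: \<delta>_def intro!: min.coboundedI2)
  interpret H: bounded_bilinear ?H
    using bilinear_hessian_form[OF U sm x] bilinear_conv_bounded_bilinear by blast
  have grad: "\<bar>?D (x + w) v - ?D x v - ?H v w\<bar> \<le> \<eta> * norm w * norm v"
    if w: "norm w < \<delta>" for v w
  proof -
    have xw: "x + w \<in> U" using w \<delta> r by (auto simp: subset_eq dist_norm)
    have "?H v w = (\<Sum>b\<in>Basis. (v \<bullet> b) * ?H b w)"
      by (rule linear_expand_Basis[of "\<lambda>v. ?H v w"]) (simp add: H.add_left H.scaleR_left linearI)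
    then have "?D (x + w) v - ?D x v - ?H v w
        = (\<Sum>b\<in>Basis. (v \<bullet> b) * (?D (x + w) b - ?D x b - ?H b w))"
      using linear_expand_Basis[OF linear_gradient[OF sm xw], of v]
        linear_expand_Basis[OF linear_gradient[OF sm x], of v]
      by (simp add: sum_subtractf right_diff_distrib)
    also have "\<bar>\<dots>\<bar> \<le> (\<Sum>b\<in>(Basis::'a set). norm v * (e * norm w))"
    proof (intro order.trans[OF sum_abs] sum_mono)
      fix b :: 'a assume b: "b \<in> Basis"
      have "\<bar>?D (x + w) b - ?D x b - ?H b w\<bar> \<le> e * norm w"
        using d(2)[of "x + w" b] w \<delta>(3)[OF b] by simp
      then show "\<bar>(v \<bullet> b) * (?D (x + w) b - ?D x b - ?H b w)\<bar> \<le> norm v * (e * norm w)"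
        using Basis_le_norm[OF b, of v] by (simp add: abs_mult mult_mono)
    qed
    also have "\<dots> = \<eta> * norm w * norm v" by (simp add: e_def)
    finally show ?thesis .
  qed
  show ?thesis
  proof (rule that[OF \<delta>(1)])
    fix v :: 'a assume v: "norm v < \<delta>"
    \<comment> \<open>\<open>g 1 - g 0\<close> is the Taylor remainder, and the derivative of
      \<open>g\<close> is the gradient error controlled by \<open>grad\<close>.\<close>
    define g where "g s = \<rho> (x + s *\<^sub>R v) - s * ?D x v - s\<^sup>2 / 2 * ?H v v" for s
    have der: "(g has_real_derivative (?D (x + s *\<^sub>R v) v - ?D x v - ?H v (s *\<^sub>R v))) (at s)"
      if s: "0 \<le> s" "s \<le> 1" for s
    proof -
      have "norm (s *\<^sub>R v) < \<delta>" using v s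
        by (metis abs_of_nonneg le_less_trans mult_left_le_one_le norm_ge_zero norm_scaleR)
      then have "x + s *\<^sub>R v \<in> U" using \<delta> r by (auto simp: subset_eq dist_norm)
      then have "(\<rho> has_derivative ?D (x + s *\<^sub>R v)) (at (x + s *\<^sub>R v))"
        using smooth_on_C2(1)[OF sm] frechet_derivative_works by blast
      then have "((\<lambda>s. \<rho> (x + s *\<^sub>R v)) has_derivative (\<lambda>t. ?D (x + s *\<^sub>R v) (t *\<^sub>R v))) (at s)"
        by (rule has_derivative_compose[rotated]) (auto intro!: derivative_eq_intros)
      moreover have "?D (x + s *\<^sub>R v) (t *\<^sub>R v) = t * ?D (x + s *\<^sub>R v) v" for t
        using linear_gradient[OF sm \<open>x + s *\<^sub>R v \<in> U\<close>] by (simp add: linear_cmul)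
      ultimately have "((\<lambda>s. \<rho> (x + s *\<^sub>R v)) has_real_derivative ?D (x + s *\<^sub>R v) v) (at s)"
        by (simp add: has_field_derivative_def mult_commute_abs)
      then show ?thesis unfolding g_def
        by (auto intro!: derivative_eq_intros simp: H.scaleR_right)
    qed
    obtain s where s: "0 < s" "s < 1"
      "g 1 - g 0 = (1 - 0) * (?D (x + s *\<^sub>R v) v - ?D x v - ?H v (s *\<^sub>R v))"
      using MVT2[of 0 1 g "\<lambda>s. ?D (x + s *\<^sub>R v) v - ?D x v - ?H v (s *\<^sub>R v)"] der by auto
    have sv: "norm (s *\<^sub>R v) \<le> norm v" using s by (simp add: mult_left_le_one_le)
    have "\<bar>g 1 - g 0\<bar> \<le> \<eta> * norm (s *\<^sub>R v) * norm v"
      using s(3) grad[of "s *\<^sub>R v" v] sv v by simp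
    also have "\<dots> \<le> \<eta> * norm v * norm v"
      using sv \<open>\<eta> > 0\<close> by (intro mult_right_mono mult_left_mono) auto
    finally show "\<bar>\<rho> (x + v) - \<rho> x - ?D x v - ?H v v / 2\<bar> \<le> \<eta> * (norm v)\<^sup>2"
      by (simp add: g_def power2_eq_square algebra_simps)
  qed
qed

section \<open>Coercivity of the Hessian and the inner normal\<close>

text \<open>Split \<open>v\<close> into its part \<open>w\<close> in the hyperplane and a multiple
  of \<nu>. Compactness of the unit sphere of the hyperplane makes \<open>H\<close> coercive on
  \<open>w\<close>; every remaining term contains the factor
  \<open>\<nu> \<bullet> v\<close>.\<close>

lemma positive_on_kernel_coercive:
  fixes H :: "'a::euclidean_space \<Rightarrow> 'a \<Rightarrow> real" and \<nu> :: 'a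
  assumes H: "bilinear H" and \<nu>: "norm \<nu> = 1"
    and pos: "\<And>v. v \<noteq> 0 \<Longrightarrow> \<nu> \<bullet> v = 0 \<Longrightarrow> H v v > 0"
  obtains c C where "c > 0" "C > 0" "\<And>v. c * (norm v)\<^sup>2 - C * \<bar>\<nu> \<bullet> v\<bar> * norm v \<le> H v v"
proof -
  interpret H: bounded_bilinear H using H bilinear_conv_bounded_bilinear by blast
  let ?S = "sphere 0 1 \<inter> {v. \<nu> \<bullet> v = 0}"
  have S: "compact ?S" by (intro compact_Int_closed closed_hyperplane) auto
  obtain c where c: "c > 0" "\<And>v. v \<in> ?S \<Longrightarrow> c \<le> H v v"
  proof (cases "?S = {}")
    case False
    have "continuous_on ?S (\<lambda>v. H v v)" by (intro H.continuous_on continuous_intros)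
    from continuous_attains_inf[OF S False this] obtain v
      where v: "v \<in> ?S" "\<And>w. w \<in> ?S \<Longrightarrow> H v v \<le> H w w" by blast
    show ?thesis
    proof (rule that[of "H v v"])
      show "H v v > 0" using v(1) by (intro pos) auto
    qed (use v in blast)
  \<comment> \<open>In real dimension one the hyperplane is trivial and its unit sphere empty, so
    any positive constant serves.\<close>
  qed (use that[of 1] in auto)
  have ker: "c * (norm v)\<^sup>2 \<le> H v v" if "\<nu> \<bullet> v = 0" for v
  proof (cases "v = 0")
    case False
    have "c \<le> H (v /\<^sub>R norm v) (v /\<^sub>R norm v)" using False that by (intro c(2)) auto
    then show ?thesis using False
      by (simp add: H.scaleR_left H.scaleR_right field_simps power2_eq_square)
  qed (simp add: H.zero_left)
  obtain B where B: "B > 0" "\<And>v w. norm (H v w) \<le> B * norm v * norm w"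
    using bilinear_bounded_pos[OF H] by blast
  show ?thesis
  \<comment> \<open>The two cross terms cost at most \<open>B\<close> each, and passing from
    \<open>norm w\<close> to \<open>norm v\<close> costs \<open>c\<close>; the third
    \<open>B\<close> leaves room.\<close>
  proof (rule that[of c "3 * B + c"])
    fix v
    define a where "a = \<nu> \<bullet> v"
    define w where "w = v - a *\<^sub>R \<nu>"
    have nn: "\<nu> \<bullet> \<nu> = 1" using \<nu> by (simp add: norm_eq_1)
    have w0: "\<nu> \<bullet> w = 0" using nn by (simp add: w_def a_def inner_diff_right)
    have v: "v = w + a *\<^sub>R \<nu>" by (simp add: w_def)
    have a_le: "\<bar>a\<bar> \<le> norm v" using Cauchy_Schwarz_ineq2[of \<nu> v] \<nu> by (simp add: a_def)
    have norm_v: "(norm v)\<^sup>2 = (norm w)\<^sup>2 + a\<^sup>2"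
      unfolding v power2_norm_eq_inner using w0 nn
      by (simp add: inner_add_left inner_add_right inner_commute power2_eq_square)
    then have w_le: "norm w \<le> norm v" by (metis le_add_same_cancel1 norm_ge_zero power2_le_imp_le zero_le_power2)
    have exp: "H v v = H w w + a * H w \<nu> + a * H \<nu> v"
    proof -
      have "H v v = H w v + a * H \<nu> v" by (subst v) (simp add: H.add_left H.scaleR_left)
      also have "H w v = H w w + a * H w \<nu>" by (subst v) (simp add: H.add_right H.scaleR_right)
      finally show ?thesis .
    qed
    have "\<bar>a * H w \<nu>\<bar> \<le> \<bar>a\<bar> * (B * norm v)"
      using B(2)[of w \<nu>] w_le B(1) \<nu> by (simp add: abs_mult mult_left_mono order.trans[OF _ mult_left_mono])
    moreover have "\<bar>a * H \<nu> v\<bar> \<le> \<bar>a\<bar> * (B * norm v)"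
      using B(2)[of \<nu> v] \<nu> by (simp add: abs_mult mult_left_mono)
    moreover have "c * (norm w)\<^sup>2 \<ge> c * (norm v)\<^sup>2 - c * (\<bar>a\<bar> * norm v)"
    proof -
      have "a\<^sup>2 \<le> \<bar>a\<bar> * norm v" using mult_left_mono[OF a_le, of "\<bar>a\<bar>"] by (simp add: power2_eq_square)
      then show ?thesis using norm_v c(1) by (simp add: algebra_simps)
    qed
    moreover have "0 \<le> \<bar>a\<bar> * (B * norm v)" using B by simp
    ultimately show "c * (norm v)\<^sup>2 - (3 * B + c) * \<bar>\<nu> \<bullet> v\<bar> * norm v \<le> H v v"
      using exp ker[OF w0] unfolding a_def[symmetric] by (simp add: algebra_simps)
  qed (use c B in auto)
qed

text \<open>The sign suits the differential of a defining function, which is negative inside the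
  domain: \<nu> then points inwards, and \<open>a\<close> is the length of the gradient.\<close>

lemma linear_functional_normalized:
  fixes D :: "'a::euclidean_space \<Rightarrow> real"
  assumes D: "linear D" and nz: "D u \<noteq> 0"
  obtains \<nu> a where "norm \<nu> = 1" "a > 0" "\<And>v. D v = - a * (\<nu> \<bullet> v)"
proof -
  define g where "g = (\<Sum>b\<in>Basis. D b *\<^sub>R b)"
  have Dg: "D v = g \<bullet> v" for v
    unfolding g_def inner_sum_left
    by (subst linear_expand_Basis[OF D]) (simp add: inner_commute mult.commute)
  then have "g \<noteq> 0" using nz by auto
  then show ?thesis
    by (intro that[of "- (g /\<^sub>R norm g)" "norm g"]) (auto simp: Dg)
qed

text \<open>\<open>\<nu>\<close> is the inner unit normal at \<open>p\<close>. Convexity upgrades the local estimate given by the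
  Hessian to the whole domain: the ratio of both sides is monotone along rays from \<open>p\<close>.\<close>

lemma strongly_convex_boundary_geometry:
  fixes \<Omega> :: "'a::euclidean_space set"
  assumes \<Omega>: "smooth_bounded_strongly_convex_domain \<Omega>" and p: "p \<in> frontier \<Omega>"
  obtains \<nu> c M \<delta> where "norm \<nu> = 1" "c > 0" "M > 0" "\<delta> > 0"
    "\<And>w. w \<in> \<Omega> \<Longrightarrow> c * (norm (w - p))\<^sup>2 \<le> \<nu> \<bullet> (w - p)"
    "\<And>z. norm (z - p) < \<delta> \<Longrightarrow> M * (norm (z - p))\<^sup>2 < \<nu> \<bullet> (z - p) \<Longrightarrow> z \<in> \<Omega>"
proof -
  obtain U \<rho> where op: "open \<Omega>" and bd: "bounded \<Omega>" and cv: "convex \<Omega>"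
    and df: "smooth_defining_function \<Omega> U \<rho>"
    and pos: "\<And>p v. p \<in> frontier \<Omega> \<Longrightarrow> v \<noteq> 0 \<Longrightarrow> frechet_derivative \<rho> (at p) v = 0 \<Longrightarrow>
        hessian_form \<rho> p v v > 0"
    using \<Omega> unfolding smooth_bounded_strongly_convex_domain_def by blast
  have U: "open U" and pU: "p \<in> U" and sm: "smooth_on U \<rho>"
    and neg: "\<And>x. x \<in> U \<Longrightarrow> x \<in> \<Omega> \<longleftrightarrow> \<rho> x < 0"
    and nz: "\<exists>v. frechet_derivative \<rho> (at p) v \<noteq> 0"
    using df p unfolding smooth_defining_function_def by blast+
  have pcl: "p \<in> closure \<Omega>" and pn: "p \<notin> \<Omega>" using p op by (auto simp: frontier_def interior_open)
  \<comment> \<open>A positive value would persist on a neighbourhood of \<open>p\<close>, which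
    meets \<Omega> because \<open>p\<close> lies in its closure.\<close>
  have \<rho>p: "\<rho> p = 0"
  proof (rule ccontr)
    assume "\<rho> p \<noteq> 0"
    then have "\<rho> p > 0" using neg[OF pU] pn by auto
    moreover have "isCont \<rho> p"
      using smooth_on_C2(1)[OF sm pU] differentiable_imp_continuous_within by blast
    ultimately have "\<forall>\<^sub>F x in at p. \<rho> x > 0" by (auto simp: isCont_def order_tendsto_iff)
    then have "\<forall>\<^sub>F x in nhds p. \<rho> x > 0 \<and> x \<in> U"
      using \<open>\<rho> p > 0\<close> U pU by (auto simp: eventually_at_filter eventually_conj_iff
          intro: eventually_nhds_in_open elim: eventually_mono)
    then obtain V where "open V" "p \<in> V" "\<And>x. x \<in> V \<Longrightarrow> \<rho> x > 0 \<and> x \<in> U"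
      by (auto simp: eventually_nhds)
    moreover then have "V \<inter> \<Omega> \<noteq> {}" using pcl by (meson open_Int_closure_eq_empty disjoint_iff)
    ultimately show False using neg by fastforce
  qed
  let ?D = "frechet_derivative \<rho> (at p)" and ?H = "hessian_form \<rho> p"
  obtain u where "?D u \<noteq> 0" using nz by blast
  then obtain \<nu> a where \<nu>: "norm \<nu> = 1" and a: "a > 0" and D: "\<And>v. ?D v = - a * (\<nu> \<bullet> v)"
    using linear_functional_normalized[OF linear_gradient[OF sm pU]] by metis
  have bil: "bilinear ?H" by (rule bilinear_hessian_form[OF U sm pU])
  obtain k C where k: "k > 0" and C: "C > 0"
    and coer: "\<And>v. k * (norm v)\<^sup>2 - C * \<bar>\<nu> \<bullet> v\<bar> * norm v \<le> ?H v v"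
    by (rule positive_on_kernel_coercive[OF bil \<nu>]) (use pos[OF p] D in auto)
  obtain B where B: "B > 0" "\<And>v w. norm (?H v w) \<le> B * norm v * norm w"
    using bilinear_bounded_pos[OF bil] by blast
  \<comment> \<open>The error \<open>k / 4\<close> is half of the coefficient \<open>k / 2\<close>
    contributed by the Hessian, so a positive quadratic term survives.\<close>
  obtain \<delta>0 where \<delta>0: "\<delta>0 > 0" and tay: "\<And>v. norm v < \<delta>0 \<Longrightarrow>
      \<bar>\<rho> (p + v) - \<rho> p - ?D v - ?H v v / 2\<bar> \<le> k / 4 * (norm v)\<^sup>2"
    using second_order_Taylor[OF U sm pU, of "k / 4"] k by auto
  obtain r where r: "r > 0" "ball p r \<subseteq> U" using U pU openE by blast
  define \<delta> where "\<delta> = min r (min \<delta>0 1)"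
  have \<delta>: "\<delta> > 0" "\<delta> \<le> \<delta>0" "\<delta> \<le> 1" "\<delta> \<le> r" using \<delta>0 r by (auto simp: \<delta>_def)
  have inU: "p + v \<in> U" if "norm v < \<delta>" for v
    using that \<delta> r by (auto simp: subset_eq dist_norm)
  \<comment> \<open>Above this paraboloid the linear term of \<rho> outweighs the Hessian and the
    Taylor error.\<close>
  have "z \<in> \<Omega>" if z: "norm (z - p) < \<delta>" and zz: "(B / 2 + k / 4) / a * (norm (z - p))\<^sup>2 < \<nu> \<bullet> (z - p)" for z
  proof -
    let ?v = "z - p"
    have "\<rho> (p + ?v) \<le> - a * (\<nu> \<bullet> ?v) + ?H ?v ?v / 2 + k / 4 * (norm ?v)\<^sup>2"
      using tay[of ?v] z \<delta>(2) \<rho>p D[of ?v] by linarith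
    also have "?H ?v ?v \<le> B * (norm ?v)\<^sup>2" using B(2)[of ?v ?v] by (simp add: power2_eq_square mult.assoc)
    also have "- a * (\<nu> \<bullet> ?v) + B * (norm ?v)\<^sup>2 / 2 + k / 4 * (norm ?v)\<^sup>2 < 0"
      using zz a by (simp add: field_simps)
    finally show "z \<in> \<Omega>" using neg[OF inU[OF z]] by simp
  qed
  note inner = this
  have seg: "p + s *\<^sub>R (w - p) \<in> \<Omega>" if "w \<in> \<Omega>" "0 < s" "s \<le> 1" for w s
  proof -
    have "p - s *\<^sub>R (p - w) \<in> interior \<Omega>"
      by (rule mem_interior_closure_convex_shrink[OF cv]) (use that op pcl in \<open>auto simp: interior_open\<close>)
    then show ?thesis using op by (simp add: interior_open algebra_simps)
  qed
  \<comment> \<open>The value comes from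
    \<open>k / 4 * (norm v)\<^sup>2 \<le> (a + C) * (\<nu> \<bullet> v)\<close>, obtained below from
    the negativity of \<rho> on \<Omega>.\<close>
  define m where "m = k / (4 * (a + C))"
  have m: "m > 0" using k a C by (simp add: m_def)
  have local: "m * (norm (w - p))\<^sup>2 \<le> \<nu> \<bullet> (w - p)" if w: "w \<in> \<Omega>" "norm (w - p) < \<delta>" for w
  proof -
    define v where "v = w - p"
    have pv: "p + v = w" by (simp add: v_def)
    \<comment> \<open>For \<open>\<nu> \<bullet> v < 0\<close> the linear term would make \<rho>
      positive at \<open>p + s *\<^sub>R v\<close> for small \<open>s\<close>, although convexity
      keeps that point in \<Omega>. The sign removes the absolute value in
      \<open>coer\<close>.\<close>
    have supp: "\<nu> \<bullet> v \<ge> 0"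
    proof (rule ccontr)
      assume "\<not> \<nu> \<bullet> v \<ge> 0"
      then have n: "\<nu> \<bullet> v < 0" by simp
      define K where "K = (B / 2 + k / 4) * (norm v)\<^sup>2"
      define s where "s = min 1 (a * - (\<nu> \<bullet> v) / (2 * (K + 1)))"
      have K: "K \<ge> 0" using B k by (simp add: K_def)
      have s: "s > 0" "s \<le> 1" "s * K < a * - (\<nu> \<bullet> v)"
      proof -
        show "s > 0" using n a K by (simp add: s_def divide_neg_pos mult_pos_neg)
        have "s * K \<le> s * (2 * (K + 1))" using \<open>s > 0\<close> K by (intro mult_left_mono) auto
        then have "s * K < s * (2 * (K + 1))" using \<open>s > 0\<close> K by (intro mult_strict_left_mono) auto
        also have "\<dots> \<le> a * - (\<nu> \<bullet> v) / (2 * (K + 1)) * (2 * (K + 1))"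
          using K by (intro mult_right_mono) (auto simp: s_def)
        also have "\<dots> = a * - (\<nu> \<bullet> v)" using K by simp
        finally show "s * K < a * - (\<nu> \<bullet> v)" .
      qed (simp add: s_def)
      have sv: "norm (s *\<^sub>R v) < \<delta>" using w(2)[folded v_def] s
        by (metis abs_of_pos le_less_trans less_imp_le mult_left_le_one_le norm_ge_zero norm_scaleR)
      have "\<rho> (p + s *\<^sub>R v) \<ge> - a * (\<nu> \<bullet> (s *\<^sub>R v)) + ?H (s *\<^sub>R v) (s *\<^sub>R v) / 2 - k / 4 * (norm (s *\<^sub>R v))\<^sup>2"
        using tay[of "s *\<^sub>R v"] sv \<delta>(2) \<rho>p D[of "s *\<^sub>R v"] by linarith
      moreover have "?H (s *\<^sub>R v) (s *\<^sub>R v) \<ge> - (B * (norm (s *\<^sub>R v))\<^sup>2)"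
        using B(2)[of "s *\<^sub>R v" "s *\<^sub>R v"] by (simp add: power2_eq_square mult.assoc)
      ultimately have "\<rho> (p + s *\<^sub>R v) \<ge> - a * (\<nu> \<bullet> (s *\<^sub>R v)) - (B / 2 + k / 4) * (norm (s *\<^sub>R v))\<^sup>2"
        by (simp add: algebra_simps)
      moreover have "- a * (\<nu> \<bullet> (s *\<^sub>R v)) - (B / 2 + k / 4) * (norm (s *\<^sub>R v))\<^sup>2
          = s * (a * - (\<nu> \<bullet> v) - s * K)"
      proof -
        have "(norm (s *\<^sub>R v))\<^sup>2 = s * (s * (norm v)\<^sup>2)"
          unfolding norm_scaleR power_mult_distrib by (simp add: power2_eq_square)
        then show ?thesis unfolding K_def inner_scaleR_right
          by (simp only:) (simp add: field_simps)
      qed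
      moreover have "s * (a * - (\<nu> \<bullet> v) - s * K) > 0" using s by simp
      ultimately have "\<rho> (p + s *\<^sub>R v) > 0" by (simp del: norm_scaleR inner_scaleR_right)
      then show False using neg[OF inU[OF sv]] seg[OF w(1) s(1,2), folded v_def] by linarith
    qed
    have "\<rho> (p + v) \<ge> - a * (\<nu> \<bullet> v) + ?H v v / 2 - k / 4 * (norm v)\<^sup>2"
      using tay[of v] w(2)[folded v_def] \<delta>(2) \<rho>p D[of v] by linarith
    moreover have "\<rho> (p + v) < 0" using neg[OF inU[OF w(2)[folded v_def]]] w pv by simp
    ultimately have "k / 4 * (norm v)\<^sup>2 \<le> a * (\<nu> \<bullet> v) + C * (\<nu> \<bullet> v) * norm v / 2"
      using coer[of v] supp by (simp add: field_simps)
    also have "\<dots> \<le> a * (\<nu> \<bullet> v) + C * (\<nu> \<bullet> v)"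
    proof -
      have "(\<nu> \<bullet> v) * norm v \<le> (\<nu> \<bullet> v) * 2" using supp w(2)[folded v_def] \<delta> by (intro mult_left_mono) auto
      then show ?thesis using C by simp
    qed
    finally show ?thesis unfolding v_def[symmetric] using a C by (simp add: m_def field_simps)
  qed
  obtain R where R: "R > 0" "\<And>w. w \<in> \<Omega> \<Longrightarrow> norm (w - p) \<le> R"
  proof -
    obtain b where "b > 0" "\<And>w. w \<in> \<Omega> \<Longrightarrow> norm w \<le> b" using bd bounded_pos by metis
    then show ?thesis
      by (intro that[of "b + norm p"]) (auto intro: add_pos_nonneg order.trans[OF norm_triangle_ineq4])
  qed
  \<comment> \<open>A point at distance \<open>t\<close> from \<open>p\<close> with
    \<open>\<delta> \<le> t\<close> is pulled towards \<open>p\<close> to distance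
    \<open>\<delta> / 2\<close>. Scaling back loses the factor \<open>\<delta> / (2 * t)\<close>,
    which is at least \<open>\<delta> / (2 * R)\<close>.\<close>
  define c where "c = m * min 1 (\<delta> / (2 * R))"
  have c: "c > 0" using m \<delta> R by (simp add: c_def)
  have "c * (norm (w - p))\<^sup>2 \<le> \<nu> \<bullet> (w - p)" if w: "w \<in> \<Omega>" for w
  proof (cases "norm (w - p) < \<delta>")
    case True
    have "c \<le> m" using m by (simp add: c_def mult_left_le)
    then have "c * (norm (w - p))\<^sup>2 \<le> m * (norm (w - p))\<^sup>2" by (intro mult_right_mono) auto
    then show ?thesis using local[OF w True] by simp
  next
    case False
    define t where "t = norm (w - p)"
    have t: "t > 0" "\<delta> \<le> t" "t \<le> R" using False \<delta> R(2)[OF w] by (auto simp: t_def)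
    define s where "s = \<delta> / (2 * t)"
    have s: "0 < s" "s \<le> 1" "s * t < \<delta>" using t \<delta> by (auto simp: s_def field_simps)
    have "m * (norm (s *\<^sub>R (w - p)))\<^sup>2 \<le> \<nu> \<bullet> (s *\<^sub>R (w - p))"
      using local[OF seg[OF w s(1,2)]] s by (simp add: t_def)
    then have "s * (m * s * t\<^sup>2) \<le> s * (\<nu> \<bullet> (w - p))"
      unfolding norm_scaleR power_mult_distrib inner_scaleR_right t_def[symmetric]
      by (simp add: power2_eq_square mult_ac)
    then have "m * s * t\<^sup>2 \<le> \<nu> \<bullet> (w - p)" using s by simp
    moreover have "c \<le> m * s"
    proof -
      have "\<delta> / (2 * R) \<le> s" using t \<delta> by (simp add: s_def frac_le)
      then show ?thesis using m unfolding c_def by (intro mult_left_mono) auto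
    qed
    then have "c * t\<^sup>2 \<le> m * s * t\<^sup>2" by (intro mult_right_mono) auto
    ultimately show ?thesis by (simp add: t_def)
  qed
  moreover have "(B / 2 + k / 4) / a > 0" using B k a by (intro divide_pos_pos add_pos_pos) auto
  ultimately show ?thesis using that[OF \<nu> c _ \<delta>(1)] inner by blast
qed

section \<open>Volumes of caps\<close>

text \<open>The range of \<open>\<nu> \<bullet> x\<close> is half-open, so that the ranges of
  consecutive translates along \<nu> tile the line without overlap.\<close>

definition slab :: "'a::euclidean_space \<Rightarrow> real \<Rightarrow> real \<Rightarrow> real \<Rightarrow> 'a set" where
  "slab \<nu> R a b = {x. norm x \<le> R \<and> a \<le> \<nu> \<bullet> x \<and> \<nu> \<bullet> x < b}"

lemma slab_borel [measurable]: "slab \<nu> R a b \<in> sets borel"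
  unfolding slab_def by measurable

lemma slab_finite: "emeasure lborel (slab \<nu> R a b) < \<infinity>"
proof -
  have "emeasure lborel (slab \<nu> R a b) \<le> emeasure lborel (cball (0::'a) R)"
    by (intro emeasure_mono) (auto simp: slab_def)
  then show ?thesis using emeasure_lborel_cball_finite[of "0::'a" R] by (simp add: le_less_trans)
qed

lemma emeasure_lborel_translate:
  fixes A :: "'a::euclidean_space set"
  assumes "A \<in> sets borel"
  shows "emeasure lborel {x. x - v \<in> A} = emeasure lborel A"
proof -
  have "emeasure lborel A = emeasure (distr lborel borel ((+) (- v))) A"
    by (simp add: lborel_distr_plus)
  also have "\<dots> = emeasure lborel {x. x - v \<in> A}"
    using assms by (subst emeasure_distr) (auto simp: vimage_def)
  finally show ?thesis by simp
qed

lemma measure_lborel_translate: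
  fixes A :: "'a::euclidean_space set"
  assumes "A \<in> sets borel"
  shows "measure lborel {x. x - v \<in> A} = measure lborel A"
  using emeasure_lborel_translate[OF assms] by (simp add: measure_def)

lemma translate_borel [measurable]:
  fixes A :: "'a::euclidean_space set"
  shows "A \<in> sets borel \<Longrightarrow> {x. x - v \<in> A} \<in> sets borel"
  using measurable_sets[of "\<lambda>x. x - v" borel borel A] by (simp add: vimage_def)

text \<open>About \<open>R / t\<close> disjoint translates of the slab fit into a ball of twice the radius.\<close>

lemma measure_slab_le:
  fixes \<nu> :: "'a::euclidean_space"
  assumes \<nu>: "norm \<nu> = 1" and t: "0 < t" "t \<le> R"
  shows "measure lborel (slab \<nu> R a (a + t))
    \<le> 2 ^ Suc DIM('a) * unit_ball_vol DIM('a) * t * R ^ (DIM('a) - 1)"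
proof -
  let ?d = "DIM('a)" and ?S = "slab \<nu> R a (a + t)"
  \<comment> \<open>Since \<open>t \<le> R\<close>, this is at least 1, so rounding down loses at
    most a factor 2 against \<open>R / t\<close>.\<close>
  define N where "N = nat \<lfloor>R / t\<rfloor>"
  define A where "A m = {x. x - (real m * t) *\<^sub>R \<nu> \<in> ?S}" for m
  have nn: "\<nu> \<bullet> \<nu> = 1" using \<nu> by (simp add: norm_eq_1)
  have Nt: "real N * t \<le> R" "R \<le> 2 * (real N * t)"
  proof -
    have R1: "R / t \<ge> 1" using t by simp
    then have "real N \<le> R / t" "R / t < real N + 1" "N \<ge> 1" unfolding N_def by linarith+
    then have "R / t \<le> 2 * real N" by linarith
    then show "real N * t \<le> R" "R \<le> 2 * (real N * t)"
      using t \<open>real N \<le> R / t\<close> by (simp_all add: pos_divide_le_eq pos_le_divide_eq mult.assoc)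
  qed
  have slice: "a + real m * t \<le> \<nu> \<bullet> x \<and> \<nu> \<bullet> x < a + real (Suc m) * t" if "x \<in> A m" for x m
    using that nn by (auto simp: A_def slab_def inner_diff_right algebra_simps)
  have disj: "A m \<inter> A k = {}" if "m < k" for m k
  proof -
    have "real (Suc m) * t \<le> real k * t" using that t by (intro mult_right_mono) auto
    then show ?thesis using slice[of _ m] slice[of _ k] by fastforce
  qed
  have sub: "A m \<subseteq> cball 0 (2 * R)" if "m < N" for m
  proof
    fix x assume "x \<in> A m"
    then have "norm (x - (real m * t) *\<^sub>R \<nu>) \<le> R" by (simp add: A_def slab_def)
    moreover have "norm ((real m * t) *\<^sub>R \<nu>) \<le> R"
    proof -
      have "real m * t \<le> real N * t" using that t by (intro mult_right_mono) auto
      then have "real m * t \<le> R" using Nt by linarith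
      then show ?thesis using t \<nu> by simp
    qed
    ultimately show "x \<in> cball 0 (2 * R)"
      using norm_triangle_sub[of x "(real m * t) *\<^sub>R \<nu>"] by simp
  qed
  have meas: "A m \<in> sets lborel" for m by (simp add: A_def translate_borel slab_borel)
  have fin: "emeasure lborel (A m) \<noteq> \<infinity>" for m
    using slab_finite[of \<nu> R a "a + t"] by (simp add: A_def emeasure_lborel_translate slab_borel)
  have "real N * measure lborel ?S = (\<Sum>m<N. measure lborel (A m))"
    by (simp add: A_def measure_lborel_translate slab_borel)
  also have "\<dots> = measure lborel (\<Union>m<N. A m)"
    using meas fin disj
    by (intro measure_finite_Union[symmetric]) (auto simp: disjoint_family_on_def, metis IntI empty_iff linorder_neqE_nat)
  also have "\<dots> \<le> measure lborel (cball (0::'a) (2 * R))"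
    using sub meas by (intro measure_mono_fmeasurable)
      (auto intro!: sets.finite_UN fmeasurableI2 simp: fmeasurable_def emeasure_lborel_cball_finite[unfolded infinity_ennreal_def])
  also have "\<dots> = unit_ball_vol ?d * (2 * R) ^ ?d" using t by (simp add: content_cball)
  finally have N: "real N * measure lborel ?S \<le> unit_ball_vol ?d * (2 * R) ^ ?d" .
  have "R * measure lborel ?S \<le> 2 * (real N * t) * measure lborel ?S"
    using Nt by (intro mult_right_mono) auto
  also have "\<dots> = 2 * t * (real N * measure lborel ?S)" by simp
  also have "\<dots> \<le> 2 * t * (unit_ball_vol ?d * (2 * R) ^ ?d)"
    using N t by (intro mult_left_mono) auto
  also have "(2 * R) ^ ?d = 2 ^ ?d * (R * R ^ (?d - 1))"
    using power_minus_mult[of ?d R] by (simp add: power_mult_distrib mult.commute)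
  also have "2 * t * (unit_ball_vol ?d * (2 ^ ?d * (R * R ^ (?d - 1))))
      = R * (2 ^ Suc ?d * unit_ball_vol ?d * t * R ^ (?d - 1))" by simp
  finally have "R * measure lborel ?S \<le> R * (2 ^ Suc ?d * unit_ball_vol ?d * t * R ^ (?d - 1))" .
  then show ?thesis using t by simp
qed

text \<open>About \<open>R / t\<close> translates of the slab cover a ball of half the radius.\<close>

lemma measure_slab_ge:
  fixes \<nu> :: "'a::euclidean_space"
  assumes \<nu>: "norm \<nu> = 1" and t: "0 < t" "4 * t \<le> R"
  shows "unit_ball_vol DIM('a) / (3 * 2 ^ DIM('a)) * t * R ^ (DIM('a) - 1)
    \<le> measure lborel (slab \<nu> R t (2 * t))"
proof -
  let ?d = "DIM('a)" and ?S = "slab \<nu> R t (2 * t)"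
  \<comment> \<open>The cover needs shifts in both directions along \<nu>, hence integer
    indices.\<close>
  define N where "N = \<lfloor>R / t\<rfloor>"
  define A where "A m = {x. x - (real_of_int m * t) *\<^sub>R \<nu> \<in> ?S}" for m
  have nn: "\<nu> \<bullet> \<nu> = 1" using \<nu> by (simp add: norm_eq_1)
  have R1: "R / t \<ge> 4" "R > 0" using t by (auto simp: field_simps)
  have N: "N \<ge> 4" "of_int N \<le> R / t" using R1 by (auto simp: N_def le_floor_iff)
  have cover: "cball 0 (R / 2) \<subseteq> (\<Union>m\<in>{-N..N}. A m)"
  proof
    fix x :: 'a assume "x \<in> cball 0 (R / 2)"
    then have x: "norm x \<le> R / 2" by simp
    define \<alpha> where "\<alpha> = \<nu> \<bullet> x"
    have \<alpha>: "\<bar>\<alpha>\<bar> \<le> R / 2" using Cauchy_Schwarz_ineq2[of \<nu> x] \<nu> x by (simp add: \<alpha>_def)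
    \<comment> \<open>The \<open>- 1\<close> places the remaining height \<open>\<alpha> - s\<close>
      between \<open>t\<close> and \<open>2 * t\<close> instead of between 0 and
      \<open>t\<close>.\<close>
    define m where "m = \<lfloor>\<alpha> / t\<rfloor> - 1"
    define s where "s = of_int m * t"
    define y where "y = x - s *\<^sub>R \<nu>"
    have "of_int m + 1 \<le> \<alpha> / t" "\<alpha> / t < of_int m + 2" unfolding m_def by linarith+
    then have s: "t \<le> \<alpha> - s" "\<alpha> - s < 2 * t" using t by (auto simp: s_def field_simps)
    have "2 * (\<alpha> / t) \<le> R / t" "- (R / t) \<le> 2 * (\<alpha> / t)"
      using \<alpha> t by (auto simp: field_simps)
    then have "- (R / t) \<le> of_int m" "of_int m \<le> R / t"
      using R1 of_int_floor_le[of "\<alpha> / t"] real_of_int_floor_add_one_gt[of "\<alpha> / t"]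
      unfolding m_def of_int_diff of_int_1 by linarith+
    then have "m \<le> N" "- m \<le> N" unfolding N_def le_floor_iff by simp_all
    then have mN: "m \<in> {-N..N}" by simp
    have ny: "\<nu> \<bullet> y = \<alpha> - s" using nn by (simp add: y_def \<alpha>_def inner_diff_right)
    \<comment> \<open>The translation changes only the normal component; the new one is below
      \<open>2 * t\<close>, hence at most \<open>R / 2\<close> because
      \<open>4 * t \<le> R\<close>.\<close>
    have "(norm y)\<^sup>2 = (norm x)\<^sup>2 - \<alpha>\<^sup>2 + (\<alpha> - s)\<^sup>2"
      unfolding y_def power2_norm_eq_inner using nn
      by (simp add: \<alpha>_def inner_diff_left inner_diff_right inner_commute power2_eq_square algebra_simps)
    also have "\<dots> \<le> (R / 2)\<^sup>2 + (R / 2)\<^sup>2"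
    proof -
      have "(norm x)\<^sup>2 \<le> (R / 2)\<^sup>2" using x by (intro power_mono) auto
      moreover have "(\<alpha> - s)\<^sup>2 \<le> (R / 2)\<^sup>2" using s t by (intro power_mono) auto
      ultimately show ?thesis using zero_le_power2[of \<alpha>] by linarith
    qed
    also have "\<dots> \<le> R\<^sup>2" by (simp add: power_divide)
    finally have "norm y \<le> R" by (rule power2_le_imp_le) (use R1 in simp)
    then have "x \<in> A m" using s ny by (simp add: A_def slab_def y_def s_def)
    then show "x \<in> (\<Union>m\<in>{-N..N}. A m)" using mN by blast
  qed
  have meas: "A m \<in> sets lborel" for m by (simp add: A_def translate_borel slab_borel)
  have fin: "A m \<in> fmeasurable lborel" for m
    using slab_finite[of \<nu> R t "2 * t"]
    by (simp add: fmeasurable_def A_def emeasure_lborel_translate slab_borel translate_borel)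
  have "unit_ball_vol ?d * (R / 2) ^ ?d = measure lborel (cball (0::'a) (R / 2))"
    using R1 by (simp add: content_cball)
  also have "\<dots> \<le> measure lborel (\<Union>m\<in>{-N..N}. A m)"
    using cover fin by (intro measure_mono_fmeasurable fmeasurable.finite_UN) auto
  also have "\<dots> \<le> (\<Sum>m\<in>{-N..N}. measure lborel (A m))"
    using meas by (intro measure_UNION_le) auto
  also have "\<dots> = (2 * of_int N + 1) * measure lborel ?S"
    using N by (simp add: A_def measure_lborel_translate slab_borel)
  also have "\<dots> \<le> 3 * (R / t) * measure lborel ?S"
  proof -
    have "2 * of_int N + 1 \<le> 3 * (R / t)" using N R1 by linarith
    then show ?thesis by (intro mult_right_mono) auto
  qed
  finally have "t * (unit_ball_vol ?d * (R / 2) ^ ?d) \<le> t * (3 * (R / t) * measure lborel ?S)"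
    using t by (intro mult_left_mono) auto
  also have "\<dots> = 3 * (R * measure lborel ?S)" using t by simp
  also have "(R / 2) ^ ?d = R * R ^ (?d - 1) / 2 ^ ?d"
    using power_minus_mult[of ?d R] by (simp add: power_divide mult.commute)
  also have "t * (unit_ball_vol ?d * (R * R ^ (?d - 1) / 2 ^ ?d))
      = 3 * (R * (unit_ball_vol ?d / (3 * 2 ^ ?d) * t * R ^ (?d - 1)))" by simp
  finally have "R * (unit_ball_vol ?d / (3 * 2 ^ ?d) * t * R ^ (?d - 1)) \<le> R * measure lborel ?S"
    by linarith
  then show ?thesis by (rule mult_left_le_imp_le) (rule R1(2))
qed

section \<open>Integrals concentrated on caps\<close>

text \<open>One term of the exponential series. The bound turns the polynomial growth of the layers
  into a geometric series.\<close>

lemma power_le_fact_exp: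
  fixes x :: real
  assumes "x \<ge> 0"
  shows "x ^ n \<le> fact n * exp x"
proof -
  have "(\<Sum>m\<in>{n}. x ^ m /\<^sub>R fact m) \<le> (\<Sum>m. x ^ m /\<^sub>R fact m)"
    using assms by (intro sum_le_suminf summable_exp_generic) auto
  then have "x ^ n / fact n \<le> exp x" by (simp add: exp_def divide_inverse mult.commute)
  then show ?thesis by (simp add: field_simps)
qed

text \<open>On the layer where \<open>x\<^sup>2 (\<nu> \<bullet> (w - q))\<close> lies in \<open>[j, j+1)\<close> the hypothesis confines \<open>w\<close> to
  a slab of thickness \<open>1/x\<^sup>2\<close> in a ball of radius comparable to \<open>1/x\<close>.\<close>

lemma nn_integral_peak_le:
  fixes \<Omega> :: "'a::euclidean_space set"
  assumes \<nu>: "norm \<nu> = 1" and c: "c > 0"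
    and \<Omega>: "\<And>w. w \<in> \<Omega> \<Longrightarrow> c * (norm (w - q))\<^sup>2 \<le> \<nu> \<bullet> (w - q)"
  obtains K where "K \<ge> 0"
    "\<And>x. x \<ge> 1 \<Longrightarrow> (\<integral>\<^sup>+w\<in>\<Omega>. ennreal (x ^ (DIM('a) + 1) * exp (- 2 * x\<^sup>2 * (\<nu> \<bullet> (w - q)))) \<partial>lborel) \<le> ennreal K"
proof -
  let ?d = "DIM('a)"
  \<comment> \<open>With the constant capped at 1, the radius \<open>R j\<close> contains the whole
    layer and also satisfies \<open>t \<le> R j\<close>.\<close>
  define c' where "c' = min c 1"
  have c': "0 < c'" "c' \<le> 1" using c by (auto simp: c'_def)
  have \<Omega>': "c' * (norm (w - q))\<^sup>2 \<le> \<nu> \<bullet> (w - q)" if "w \<in> \<Omega>" for w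
  proof -
    have "c' * (norm (w - q))\<^sup>2 \<le> c * (norm (w - q))\<^sup>2" by (intro mult_right_mono) (auto simp: c'_def)
    then show ?thesis using \<Omega>[OF that] by linarith
  qed
  define C where "C = 2 ^ Suc ?d * unit_ball_vol ?d"
  have C: "C \<ge> 0" by (simp add: C_def)
  \<comment> \<open>Layer \<open>j\<close> contributes at most a constant times
    \<open>exp (- 2 * real j) * (real j + 1) ^ (?d - 1)\<close>; bounding the power by a multiple of
    \<open>exp (real j + 1)\<close> leaves the ratio \<open>exp (- 1)\<close>.\<close>
  define K0 where "K0 = C * (1 / c') ^ (?d - 1) * fact (?d - 1) * exp 1"
  have K0: "K0 \<ge> 0" using C c' by (simp add: K0_def)
  have geo: "(\<lambda>j. K0 * exp (- 1) ^ j) sums (K0 * (1 / (1 - exp (- 1 :: real))))"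
    by (intro sums_mult geometric_sums) simp
  show ?thesis
  proof (rule that[of "K0 * (1 / (1 - exp (- 1)))"])
    show "K0 * (1 / (1 - exp (- 1 :: real))) \<ge> 0" using K0 by simp
    fix x :: real assume x: "x \<ge> 1"
    define t where "t = 1 / x\<^sup>2"
    define R where "R j = (real j + 1) / (c' * x)" for j
    define S where "S j = slab \<nu> (R j) (real j * t) (real j * t + t)" for j
    define A where "A j = {w. w - q \<in> S j}" for j
    have t: "t > 0" using x by (simp add: t_def)
    have tR: "t \<le> R j" for j
    proof -
      have "1 * 1 \<le> (real j + 1) * x" using x by (intro mult_mono) auto
      then have "c' \<le> (real j + 1) * x" using c' by linarith
      then show ?thesis using x c' by (simp add: t_def R_def field_simps power2_eq_square)
    qed
    have AS: "A j \<in> sets lborel" "emeasure lborel (A j) = ennreal (measure lborel (S j))" for j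
      using slab_finite[of \<nu> "R j" "real j * t" "real j * t + t"]
      by (simp_all add: A_def S_def translate_borel slab_borel emeasure_lborel_translate measure_lborel_translate emeasure_eq_ennreal_measure)
    have mS: "measure lborel (S j) \<le> C * t * R j ^ (?d - 1)" for j
      unfolding S_def C_def by (rule measure_slab_le[OF \<nu> t tR])
    \<comment> \<open>Two powers of \<open>x\<close> cancel the thickness of the slab, the others
      its radius.\<close>
    have xd: "x ^ (?d + 1) = x\<^sup>2 * x ^ (?d - 1)"
      using DIM_positive[where 'a='a] by (simp flip: power_add)
    have layer: "x ^ (?d + 1) * exp (- 2 * real j) * measure lborel (S j) \<le> K0 * exp (- 1) ^ j" for j
    proof -
      have "x ^ (?d + 1) * exp (- 2 * real j) * measure lborel (S j)
          \<le> x ^ (?d + 1) * exp (- 2 * real j) * (C * t * R j ^ (?d - 1))"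
        using mS x by (intro mult_left_mono) auto
      also have "\<dots> = C * (1 / c') ^ (?d - 1) * exp (- 2 * real j) * (real j + 1) ^ (?d - 1)"
        using x c' unfolding xd t_def R_def by (simp add: power_divide power_mult_distrib)
      also have "\<dots> \<le> C * (1 / c') ^ (?d - 1) * exp (- 2 * real j) * (fact (?d - 1) * exp (real j + 1))"
        using C c' by (intro mult_left_mono power_le_fact_exp) auto
      also have "\<dots> = C * (1 / c') ^ (?d - 1) * fact (?d - 1) * (exp (- 2 * real j) * exp (real j + 1))"
        by (simp add: mult_ac)
      also have "exp (- 2 * real j) * exp (real j + 1) = exp 1 * exp (- 1) ^ j"
        by (simp add: exp_of_nat_mult[symmetric] mult_exp_exp)
      finally show ?thesis by (simp add: K0_def mult_ac)
    qed
    have "(\<integral>\<^sup>+w\<in>\<Omega>. ennreal (x ^ (?d + 1) * exp (- 2 * x\<^sup>2 * (\<nu> \<bullet> (w - q)))) \<partial>lborel)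
        \<le> (\<integral>\<^sup>+w. (\<Sum>j. ennreal (x ^ (?d + 1) * exp (- 2 * real j)) * indicator (A j) w) \<partial>lborel)"
    proof (rule nn_integral_mono)
      fix w :: 'a
      show "ennreal (x ^ (?d + 1) * exp (- 2 * x\<^sup>2 * (\<nu> \<bullet> (w - q)))) * indicator \<Omega> w
          \<le> (\<Sum>j. ennreal (x ^ (?d + 1) * exp (- 2 * real j)) * indicator (A j) w)"
      proof (cases "w \<in> \<Omega>")
        case True
        define s where "s = \<nu> \<bullet> (w - q)"
        have ws: "c' * (norm (w - q))\<^sup>2 \<le> s" using \<Omega>'[OF True] by (simp add: s_def)
        then have s: "s \<ge> 0" using c' by (smt (verit) mult_nonneg_nonneg zero_le_power2)
        define j where "j = nat \<lfloor>x\<^sup>2 * s\<rfloor>"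
        have j: "real j \<le> x\<^sup>2 * s" "x\<^sup>2 * s < real j + 1"
          using s unfolding j_def by (auto simp: of_nat_nat)
        have "norm (w - q) \<le> R j"
        proof (rule power2_le_imp_le)
          have "(c' * x * norm (w - q))\<^sup>2 = c' * (x\<^sup>2 * (c' * (norm (w - q))\<^sup>2))"
            by (simp add: power_mult_distrib power2_eq_square)
          also have "\<dots> \<le> 1 * (x\<^sup>2 * s)" using c' ws s by (intro mult_mono) auto
          also have "\<dots> \<le> (real j + 1) * (real j + 1)"
          proof -
            have "1 * (x\<^sup>2 * s) \<le> (real j + 1) * 1" using j by simp
            also have "\<dots> \<le> (real j + 1) * (real j + 1)" by (intro mult_left_mono) auto
            finally show ?thesis .
          qed
          finally show "(norm (w - q))\<^sup>2 \<le> (R j)\<^sup>2"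
            using x c' by (simp add: R_def power_divide power_mult_distrib field_simps power2_eq_square)
          show "0 \<le> R j" using x c' by (simp add: R_def)
        qed
        moreover have "real j * t \<le> s" "s < real j * t + t"
          using j x by (auto simp: t_def field_simps)
        ultimately have "w \<in> A j" by (simp add: A_def S_def slab_def s_def)
        have "ennreal (x ^ (?d + 1) * exp (- 2 * x\<^sup>2 * s)) \<le> ennreal (x ^ (?d + 1) * exp (- 2 * real j))"
          using j x by (intro ennreal_leI mult_left_mono) auto
        also have "\<dots> = (\<Sum>i\<in>{j}. ennreal (x ^ (?d + 1) * exp (- 2 * real i)) * indicator (A i) w)"
          using \<open>w \<in> A j\<close> by simp
        also have "\<dots> \<le> (\<Sum>i. ennreal (x ^ (?d + 1) * exp (- 2 * real i)) * indicator (A i) w)"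
          by (rule sum_le_suminf) auto
        finally show ?thesis using True by (simp add: s_def)
      qed simp
    qed
    also have "\<dots> = (\<Sum>j. \<integral>\<^sup>+w. ennreal (x ^ (?d + 1) * exp (- 2 * real j)) * indicator (A j) w \<partial>lborel)"
      using AS by (intro nn_integral_suminf) auto
    also have "\<dots> = (\<Sum>j. ennreal (x ^ (?d + 1) * exp (- 2 * real j) * measure lborel (S j)))"
      using AS x by (simp add: nn_integral_cmult_indicator ennreal_mult)
    also have "\<dots> \<le> (\<Sum>j. ennreal (K0 * exp (- 1) ^ j))"
      using layer by (intro suminf_le ennreal_leI) auto
    also have "\<dots> = ennreal (K0 * (1 / (1 - exp (- 1))))"
      using K0 geo by (intro suminf_ennreal_eq) auto
    finally show "(\<integral>\<^sup>+w\<in>\<Omega>. ennreal (x ^ (?d + 1) * exp (- 2 * x\<^sup>2 * (\<nu> \<bullet> (w - q)))) \<partial>lborel)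
        \<le> ennreal (K0 * (1 / (1 - exp (- 1))))" .
  qed
qed

text \<open>It suffices to integrate over a slab of radius \<open>s / x\<close> at heights between
  \<open>1 / x\<^sup>2\<close> and \<open>2 / x\<^sup>2\<close>: there
  \<open>x\<^sup>2 * u z\<close> is bounded above, and the volume cancels the power of
  \<open>x\<close>.\<close>

lemma nn_integral_peak_ge:
  fixes \<Omega> :: "'a::euclidean_space set"
  assumes \<nu>: "norm \<nu> = 1" and pos: "M > 0" "\<delta> > 0" "A \<ge> 0" "B \<ge> 0"
    and \<Omega>: "\<And>z. norm (z - p) < \<delta> \<Longrightarrow> M * (norm (z - p))\<^sup>2 < \<nu> \<bullet> (z - p) \<Longrightarrow> z \<in> \<Omega>"
    and u: "\<And>z. norm (z - p) < \<delta> \<Longrightarrow> u z \<le> A * (\<nu> \<bullet> (z - p)) + B * (norm (z - p))\<^sup>2"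
  obtains c X where "c > 0"
    "\<And>x. x \<ge> X \<Longrightarrow> ennreal c \<le> (\<integral>\<^sup>+z\<in>\<Omega>. ennreal (x ^ (DIM('a) + 1) * exp (- 2 * x\<^sup>2 * u z)) \<partial>lborel)"
proof -
  let ?d = "DIM('a)"
  \<comment> \<open>Small enough that on the slab the height beats the quadratic term, which puts
    the slab inside \<Omega>.\<close>
  define s where "s = 1 / (M + 1)"
  have s: "s > 0" "M * s\<^sup>2 < 1"
  proof -
    show "s > 0" using pos by (simp add: s_def)
    have "M < (M + 1)\<^sup>2" using pos by (simp add: power2_eq_square algebra_simps add_pos_pos)
    then show "M * s\<^sup>2 < 1" using pos by (simp add: s_def power_divide)
  qed
  define L where "L = 2 * A + B * s\<^sup>2"
  define C where "C = unit_ball_vol ?d / (3 * 2 ^ ?d)"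
  have C: "C > 0" by (simp add: C_def unit_ball_vol_pos)
  show ?thesis
  \<comment> \<open>The threshold \<open>4 / s\<close> ensures \<open>4 * t \<le> R\<close>, and
    \<open>2 * s / \<delta>\<close> ensures \<open>R < \<delta>\<close>.\<close>
  proof (rule that[of "exp (- 2 * L) * C * s ^ (?d - 1)" "max 1 (max (4 / s) (2 * s / \<delta>))"])
    show "exp (- 2 * L) * C * s ^ (?d - 1) > 0" using C s by simp
    fix x :: real assume "x \<ge> max 1 (max (4 / s) (2 * s / \<delta>))"
    then have x: "x \<ge> 1" "4 \<le> x * s" "2 * s \<le> x * \<delta>"
      using s pos by (auto simp: field_simps)
    define t where "t = 1 / x\<^sup>2"
    define R where "R = s / x"
    define S where "S = slab \<nu> R t (2 * t)"
    have t: "t > 0" "4 * t \<le> R" using x by (auto simp: t_def R_def field_simps power2_eq_square)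
    have R: "R < \<delta>" "R\<^sup>2 = s\<^sup>2 * t"
      using x s by (auto simp: R_def t_def field_simps power_divide)
    have inS: "z \<in> \<Omega> \<and> x\<^sup>2 * u z \<le> L" if z: "z - p \<in> S" for z
    proof -
      have zz: "norm (z - p) \<le> R" "t \<le> \<nu> \<bullet> (z - p)" "\<nu> \<bullet> (z - p) < 2 * t"
        using z by (auto simp: S_def slab_def)
      have n2: "(norm (z - p))\<^sup>2 \<le> s\<^sup>2 * t" using zz(1) R(2) by (metis norm_ge_zero power_mono)
      have "M * (norm (z - p))\<^sup>2 \<le> M * s\<^sup>2 * t" using n2 pos by simp
      also have "\<dots> < t" using s t by simp
      finally have "z \<in> \<Omega>" using zz R by (intro \<Omega>) auto
      have "u z \<le> A * (\<nu> \<bullet> (z - p)) + B * (norm (z - p))\<^sup>2" using zz R by (intro u) auto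
      also have "\<dots> \<le> A * (2 * t) + B * (s\<^sup>2 * t)"
        using zz n2 pos by (intro add_mono mult_left_mono) auto
      also have "\<dots> = L * t" by (simp add: L_def algebra_simps)
      finally have "x\<^sup>2 * u z \<le> x\<^sup>2 * (L * t)" by (intro mult_left_mono) auto
      also have "\<dots> = L" using x by (simp add: t_def)
      finally show ?thesis using \<open>z \<in> \<Omega>\<close> by simp
    qed
    have mS: "C * t * R ^ (?d - 1) \<le> measure lborel S"
      unfolding S_def C_def by (rule measure_slab_ge[OF \<nu> t])
    have AS: "{z. z - p \<in> S} \<in> sets lborel" "emeasure lborel {z. z - p \<in> S} = ennreal (measure lborel S)"
      using slab_finite[of \<nu> R t "2 * t"]
      by (simp_all add: S_def translate_borel slab_borel emeasure_lborel_translate measure_lborel_translate emeasure_eq_ennreal_measure)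
    have xd: "x ^ (?d + 1) = x\<^sup>2 * x ^ (?d - 1)"
      using DIM_positive[where 'a='a] by (simp flip: power_add)
    have "exp (- 2 * L) * C * s ^ (?d - 1) = x ^ (?d + 1) * exp (- 2 * L) * (C * t * R ^ (?d - 1))"
      using x unfolding xd t_def R_def by (simp add: power_divide)
    also have "\<dots> \<le> x ^ (?d + 1) * exp (- 2 * L) * measure lborel S"
      using mS x by (intro mult_left_mono) auto
    finally have "ennreal (exp (- 2 * L) * C * s ^ (?d - 1))
        \<le> ennreal (x ^ (?d + 1) * exp (- 2 * L)) * emeasure lborel {z. z - p \<in> S}"
      using x AS by (simp add: ennreal_mult[symmetric] ennreal_leI)
    also have "\<dots> = (\<integral>\<^sup>+z. ennreal (x ^ (?d + 1) * exp (- 2 * L)) * indicator {z. z - p \<in> S} z \<partial>lborel)"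
      using AS by (simp add: nn_integral_cmult_indicator)
    also have "\<dots> \<le> (\<integral>\<^sup>+z\<in>\<Omega>. ennreal (x ^ (?d + 1) * exp (- 2 * x\<^sup>2 * u z)) \<partial>lborel)"
    proof (rule nn_integral_mono)
      fix z :: 'a
      show "ennreal (x ^ (?d + 1) * exp (- 2 * L)) * indicator {z. z - p \<in> S} z
          \<le> ennreal (x ^ (?d + 1) * exp (- 2 * x\<^sup>2 * u z)) * indicator \<Omega> z"
      proof (cases "z - p \<in> S")
        case True
        then show ?thesis using inS[OF True] x by (auto intro!: ennreal_leI mult_left_mono)
      qed simp
    qed
    finally show "ennreal (exp (- 2 * L) * C * s ^ (?d - 1))
        \<le> (\<integral>\<^sup>+z\<in>\<Omega>. ennreal (x ^ (?d + 1) * exp (- 2 * x\<^sup>2 * u z)) \<partial>lborel)" .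
  qed
qed

text \<open>For \<open>w\<close> in the bounding hyperplane, adding \<open>w\<close> to or
  subtracting it from a small positive multiple of \<nu> stays in the open half-space. This forces
  \<open>\<bar>L w\<bar> \<le> e * L \<nu>\<close> for all positive \<open>e\<close>, so
  \<open>L\<close> vanishes on the hyperplane.\<close>

lemma linear_nonneg_on_halfspace:
  fixes L :: "'a::euclidean_space \<Rightarrow> real"
  assumes L: "linear L" and \<nu>: "norm \<nu> = 1" and pos: "\<And>v. \<nu> \<bullet> v > 0 \<Longrightarrow> L v \<ge> 0"
  shows "L \<nu> \<ge> 0" "L v = L \<nu> * (\<nu> \<bullet> v)"
proof -
  have nn: "\<nu> \<bullet> \<nu> = 1" using \<nu> by (simp add: norm_eq_1)
  show L0: "L \<nu> \<ge> 0" using pos[of \<nu>] nn by simp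
  define w where "w = v - (\<nu> \<bullet> v) *\<^sub>R \<nu>"
  have w0: "\<nu> \<bullet> w = 0" using nn by (simp add: w_def inner_diff_right)
  have "\<bar>L w\<bar> \<le> e * L \<nu>" if "e > 0" for e
  proof -
    have "0 \<le> L (w + e *\<^sub>R \<nu>)" "0 \<le> L (e *\<^sub>R \<nu> - w)"
      using that w0 nn by (auto intro!: pos simp: inner_add_right inner_diff_right)
    then show ?thesis using L by (simp add: linear_add linear_cmul linear_diff)
  qed
  note small = this
  have "L w = 0"
  proof (rule ccontr)
    assume "L w \<noteq> 0"
    \<comment> \<open>The bound now gives at most half of \<open>\<bar>L w\<bar>\<close>; the
      \<open>+ 1\<close> covers \<open>L \<nu> = 0\<close>.\<close>
    define e where "e = \<bar>L w\<bar> / (2 * (L \<nu> + 1))"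
    have e: "e > 0" "e * (2 * (L \<nu> + 1)) = \<bar>L w\<bar>" using \<open>L w \<noteq> 0\<close> L0 by (auto simp: e_def)
    have "e * L \<nu> \<ge> 0" using e L0 by simp
    then show False using small[OF e(1)] e by (simp add: algebra_simps)
  qed
  then show "L v = L \<nu> * (\<nu> \<bullet> v)"
    using L by (simp add: w_def linear_diff linear_cmul)
qed

section \<open>Holomorphic functions and peak functions\<close>

text \<open>Discs of radius \<open>r / 2\<close> about points of the half disc stay in the full
  disc, so Cauchy's inequality bounds the second derivative by
  \<open>fact 2 * M / (r / 2) ^ 2\<close>; Taylor's formula then applies.\<close>

lemma holomorphic_second_order_bound:
  assumes g: "g holomorphic_on ball 0 r" "continuous_on (cball 0 r) g"
    and M: "\<And>w. w \<in> cball 0 r \<Longrightarrow> cmod (g w) \<le> M" and r: "r > 0" and w: "cmod w < r / 2"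
  shows "cmod (g w - g 0 - deriv g 0 * w) \<le> 8 * M / r\<^sup>2 * (cmod w)\<^sup>2"
proof -
  have B: "cmod ((deriv ^^ 2) g z) \<le> 8 * M / r\<^sup>2" if z: "z \<in> ball 0 (r / 2)" for z
  proof -
    have sub: "cball z (r / 2) \<subseteq> cball 0 r"
    proof
      fix x assume "x \<in> cball z (r / 2)"
      then show "x \<in> cball 0 r" using z norm_triangle_sub[of x z] by (simp add: dist_norm norm_minus_commute)
    qed
    have sub': "ball z (r / 2) \<subseteq> ball 0 r"
    proof
      fix x assume "x \<in> ball z (r / 2)"
      then show "x \<in> ball 0 r" using z norm_triangle_sub[of x z] by (simp add: dist_norm norm_minus_commute)
    qed
    have "cmod ((deriv ^^ 2) g z) \<le> fact 2 * M / (r / 2) ^ 2"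
    proof (rule Cauchy_inequality)
      show "g holomorphic_on ball z (r / 2)" using g(1) sub' holomorphic_on_subset by blast
      show "continuous_on (cball z (r / 2)) g" using g(2) sub continuous_on_subset by blast
      show "cmod (g x) \<le> M" if "norm (z - x) = r / 2" for x
        using M[of x] sub that by (auto simp: subset_eq dist_norm)
    qed (use r in auto)
    then show ?thesis by (simp add: power_divide)
  qed
  have "cmod ((deriv ^^ 0) g w - (\<Sum>i\<le>1. (deriv ^^ i) g 0 * (w - 0) ^ i / fact i))
      \<le> 8 * M / r\<^sup>2 * cmod (w - 0) ^ Suc 1 / fact 1"
  proof (rule complex_Taylor[of "ball 0 (r / 2)" 1 "\<lambda>i. (deriv ^^ i) g"])
    fix i x assume x: "x \<in> ball (0::complex) (r / 2)"
    have "(deriv ^^ i) g holomorphic_on ball 0 r" using g(1) holomorphic_higher_deriv by blast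
    then have "((deriv ^^ i) g has_field_derivative deriv ((deriv ^^ i) g) x) (at x)"
      by (rule holomorphic_derivI) (use x r in auto)
    then show "((deriv ^^ i) g has_field_derivative (deriv ^^ Suc i) g x) (at x within ball 0 (r / 2))"
      using has_field_derivative_at_within by simp
  qed (use B w r in \<open>auto simp: numeral_2_eq_2\<close>)
  then show ?thesis by (simp add: algebra_simps power2_eq_square)
qed

lemma norm_vector_smult [simp]: "norm (c *s (v::complex^'n)) = cmod c * norm v"
  by (simp add: norm_vec_def norm_mult L2_set_right_distrib)

lemma vector_smult_linear: "linear (\<lambda>c. c *s (v::complex^'n))"
  by (rule linearI) (auto simp: vec_eq_iff algebra_simps)

lemma cn_holomorphic_on_subset: "cn_holomorphic_on f S \<Longrightarrow> T \<subseteq> S \<Longrightarrow> cn_holomorphic_on f T"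
  unfolding cn_holomorphic_on_def by blast

lemma cn_holomorphic_on_imp_continuous_on: "cn_holomorphic_on f S \<Longrightarrow> continuous_on S f"
  unfolding cn_holomorphic_on_def
  by (meson continuous_at_imp_continuous_on has_derivative_continuous)

text \<open>Restriction to the complex line through \<open>p\<close> and \<open>z\<close> reduces
  the claim to one variable. The bound \<open>M\<close> holds on a whole ball, so the constant is
  the same in all directions.\<close>

lemma cn_holomorphic_second_order_Taylor:
  fixes f :: "complex^'n \<Rightarrow> complex"
  assumes f: "cn_holomorphic_on f U" and U: "open U" "p \<in> U"
  obtains D B \<delta> where "linear D" "B > 0" "\<delta> > 0"
    "\<And>z. norm (z - p) < \<delta> \<Longrightarrow> cmod (f z - f p - D (z - p)) \<le> B * (norm (z - p))\<^sup>2"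
proof -
  obtain r0 where r0: "r0 > 0" "cball p r0 \<subseteq> U" using U open_contains_cball by blast
  have cont: "continuous_on (cball p r0) f"
    using cn_holomorphic_on_imp_continuous_on[OF f] r0 continuous_on_subset by blast
  then have "bounded (f ` cball p r0)" by (intro compact_imp_bounded compact_continuous_image) auto
  then obtain M where M: "M > 0" "\<And>z. z \<in> cball p r0 \<Longrightarrow> cmod (f z) \<le> M"
    by (auto simp: bounded_pos)
  obtain D where D: "(f has_derivative D) (at p)"
    using f U unfolding cn_holomorphic_on_def by blast
  show ?thesis
  proof (rule that[of D "8 * M / r0\<^sup>2" "r0 / 2"])
    show "linear D" using D has_derivative_linear by blast
    fix z assume z: "norm (z - p) < r0 / 2"
    show "cmod (f z - f p - D (z - p)) \<le> 8 * M / r0\<^sup>2 * (norm (z - p))\<^sup>2"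
    proof (cases "z = p")
      case True then show ?thesis using D has_derivative_linear linear_0 M by force
    next
      case False
      define a where "a = norm (z - p)"
      have a: "a > 0" using False by (simp add: a_def)
      define v where "v = (z - p) /\<^sub>R a"
      have v: "norm v = 1" "z - p = a *\<^sub>R v" using a by (auto simp: v_def a_def)
      define g where "g = (\<lambda>\<zeta>. f (p + \<zeta> *s v))"
      have in_ball: "p + \<zeta> *s v \<in> cball p r0" if "\<zeta> \<in> cball 0 r0" for \<zeta>
        using that v by (simp add: dist_norm)
      have lin: "((\<lambda>\<zeta>. p + \<zeta> *s v) has_derivative (\<lambda>t. t *s v)) (at \<zeta>)" for \<zeta>
        using linear_imp_has_derivative[OF vector_smult_linear[of v]]
        by (auto intro!: derivative_eq_intros)
      have der: "\<exists>d. (g has_field_derivative d) (at \<zeta>)" if \<zeta>: "\<zeta> \<in> cball 0 r0" for \<zeta>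
      proof -
        obtain E where E: "(f has_derivative E) (at (p + \<zeta> *s v))" "\<And>c w. E (c *s w) = c * E w"
          using f in_ball[OF \<zeta>] r0 unfolding cn_holomorphic_on_def by blast
        have "(g has_derivative (\<lambda>t. E (t *s v))) (at \<zeta>)"
          unfolding g_def using has_derivative_compose[OF lin E(1)] .
        then have "(g has_derivative (*) (E v)) (at \<zeta>)"
          unfolding E(2) by (simp add: mult_commute_abs)
        then show ?thesis unfolding has_field_derivative_def by blast
      qed
      have hol: "g holomorphic_on ball 0 r0"
        by (rule holomorphic_onI) (meson der ball_subset_cball field_differentiable_at_within
            field_differentiable_def subsetD)
      have cg: "continuous_on (cball 0 r0) g"
        by (intro continuous_at_imp_continuous_on ballI) (meson der DERIV_isCont)
      \<comment> \<open>Comparison with \<open>deriv g 0\<close> identifies the linear term of the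
        slice with \<open>D\<close>.\<close>
      have "(g has_derivative (\<lambda>t. D (t *s v))) (at 0)"
        unfolding g_def by (rule has_derivative_compose[OF lin]) (simp add: D)
      moreover have "(g has_derivative (*) (deriv g 0)) (at 0)"
        using der[of 0] r0 by (metis DERIV_imp_deriv centre_in_cball has_field_derivative_def less_imp_le)
      ultimately have "(\<lambda>t. D (t *s v)) = (*) (deriv g 0)" by (rule has_derivative_unique)
      then have Dg: "D (complex_of_real a *s v) = deriv g 0 * complex_of_real a" by metis
      have av: "complex_of_real a *s v = z - p"
        unfolding v(2) by (simp add: vec_eq_iff scaleR_conv_of_real[symmetric])
      have "cmod (g (of_real a) - g 0 - deriv g 0 * of_real a) \<le> 8 * M / r0\<^sup>2 * (cmod (of_real a))\<^sup>2"
        by (rule holomorphic_second_order_bound[OF hol cg])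
           (use M in_ball r0 z a in \<open>auto simp: g_def a_def\<close>)
      then show ?thesis
        using Dg av a by (simp add: g_def a_def)
    qed
  qed (use M r0 in auto)
qed

lemma cn_holomorphic_on_diff:
  assumes "cn_holomorphic_on f S" "cn_holomorphic_on g S"
  shows "cn_holomorphic_on (\<lambda>z. f z - g z) S"
  unfolding cn_holomorphic_on_def
proof
  fix z assume "z \<in> S"
  then obtain D E where "(f has_derivative D) (at z)" "\<forall>c v. D (c *s v) = c * D v"
    "(g has_derivative E) (at z)" "\<forall>c v. E (c *s v) = c * E v"
    using assms unfolding cn_holomorphic_on_def by meson
  then show "\<exists>D. ((\<lambda>z. f z - g z) has_derivative D) (at z) \<and> (\<forall>c v. D (c *s v) = c * D v)"
    by (intro exI[of _ "\<lambda>v. D v - E v"]) (auto intro!: derivative_eq_intros simp: algebra_simps)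
qed

section \<open>Peak functions\<close>

text \<open>The conjugation makes this complex linear in \<open>v\<close>, with the real inner
  product as its real part.\<close>

definition hermitian_form :: "complex^'n \<Rightarrow> complex^'n \<Rightarrow> complex" where
  "hermitian_form \<nu> v = (\<Sum>j\<in>UNIV. cnj (\<nu> $ j) * v $ j)"

lemma Re_hermitian_form: "Re (hermitian_form \<nu> v) = \<nu> \<bullet> v"
  by (simp add: hermitian_form_def inner_vec_def inner_complex_def)

lemma hermitian_form_smult: "hermitian_form \<nu> (c *s v) = c * hermitian_form \<nu> v"
  by (simp add: hermitian_form_def sum_distrib_left mult_ac)

lemma hermitian_form_zero [simp]: "hermitian_form \<nu> 0 = 0"
  by (simp add: hermitian_form_def)

lemma hermitian_form_has_derivative:
  "((\<lambda>w. hermitian_form \<nu> (w - q)) has_derivative hermitian_form \<nu>) (at w)"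
  unfolding hermitian_form_def
  by (auto intro!: derivative_eq_intros bounded_linear.has_derivative[OF bounded_linear_vec_nth])

lemma cn_holomorphic_on_hermitian_form:
  assumes "\<And>j. cn_holomorphic_on (\<lambda>z. \<phi> z $ j) U"
  shows "cn_holomorphic_on (\<lambda>z. hermitian_form \<nu> (\<phi> z - q)) U"
  unfolding cn_holomorphic_on_def
proof
  fix z assume "z \<in> U"
  then have "\<forall>j. \<exists>D. ((\<lambda>z. \<phi> z $ j) has_derivative D) (at z) \<and> (\<forall>c v. D (c *s v) = c * D v)"
    using assms unfolding cn_holomorphic_on_def by blast
  then obtain D where D: "\<And>j. ((\<lambda>z. \<phi> z $ j) has_derivative D j) (at z)"
    "\<And>j c v. D j (c *s v) = c * D j v" by metis
  have "((\<lambda>z. hermitian_form \<nu> (\<phi> z - q)) has_derivative (\<lambda>v. \<Sum>j\<in>UNIV. cnj (\<nu> $ j) * D j v)) (at z)"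
    unfolding hermitian_form_def by (auto intro!: derivative_eq_intros D)
  moreover have "(\<Sum>j\<in>UNIV. cnj (\<nu> $ j) * D j (c *s v)) = c * (\<Sum>j\<in>UNIV. cnj (\<nu> $ j) * D j v)" for c v
    by (simp add: D(2) sum_distrib_left mult_ac)
  ultimately show "\<exists>D. ((\<lambda>z. hermitian_form \<nu> (\<phi> z - q)) has_derivative D) (at z) \<and>
      (\<forall>c v. D (c *s v) = c * D v)" by blast
qed

text \<open>The first factor normalises against the volume of the cap. A root is taken because the
  exponent is odd, the real dimension being even.\<close>

definition peak :: "complex^'n \<Rightarrow> complex^'n \<Rightarrow> real \<Rightarrow> complex^'n \<Rightarrow> complex" where
  "peak \<nu> q x w = of_real (sqrt (x ^ (DIM(complex^'n) + 1))) * exp (- of_real (x\<^sup>2) * hermitian_form \<nu> (w - q))"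

lemma norm_peak:
  fixes w :: "complex^'n"
  assumes "x \<ge> 0"
  shows "(cmod (peak \<nu> q x w))\<^sup>2 = x ^ (DIM(complex^'n) + 1) * exp (- 2 * x\<^sup>2 * (\<nu> \<bullet> (w - q)))"
proof -
  have "(exp (- (x\<^sup>2 * (\<nu> \<bullet> (w - q)))))\<^sup>2 = exp (- 2 * x\<^sup>2 * (\<nu> \<bullet> (w - q)))"
    by (simp add: exp_double[symmetric])
  then show ?thesis using assms
    by (simp add: peak_def norm_mult power_mult_distrib Re_hermitian_form)
qed

lemma cn_holomorphic_on_peak:
  fixes \<nu> :: "complex^'n"
  shows "cn_holomorphic_on (peak \<nu> q x) S"
  unfolding cn_holomorphic_on_def
proof
  fix w
  let ?D = "\<lambda>v. peak \<nu> q x w * (- of_real (x\<^sup>2)) * hermitian_form \<nu> v"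
  have "((\<lambda>w. - of_real (x\<^sup>2) * hermitian_form \<nu> (w - q)) has_derivative
      (\<lambda>v. - of_real (x\<^sup>2) * hermitian_form \<nu> v)) (at w)"
    by (intro has_derivative_mult_right hermitian_form_has_derivative)
  from has_derivative_mult_right[OF has_derivative_compose[OF this DERIV_exp[unfolded has_field_derivative_def]],
      of "of_real (sqrt (x ^ (DIM(complex^'n) + 1)))"]
  have "(peak \<nu> q x has_derivative ?D) (at w)"
    by (simp only: peak_def[abs_def] mult.assoc)
  then show "\<exists>D. (peak \<nu> q x has_derivative D) (at w) \<and> (\<forall>c v. D (c *s v) = c * D v)"
    by (intro exI[of _ ?D]) (auto simp: hermitian_form_smult)
qed

text \<open>For parameters \<open>x\<close> at least 1 the exponent may be weakened from
  \<open>x\<^sup>2\<close> to \<open>x\<close>. What remains is a multiple of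
  \<open>y ^ d / exp y\<close> with \<open>y = 2 * a * x\<close>.\<close>

lemma peak_tendsto_0:
  fixes \<nu> :: "complex^'n"
  assumes "\<nu> \<bullet> (w - q) > 0"
  shows "(\<lambda>n. peak \<nu> q (real (Suc n)) w) \<longlonglongrightarrow> 0"
proof -
  define a where "a = \<nu> \<bullet> (w - q)"
  define d where "d = DIM(complex^'n) + 1"
  have a: "a > 0" using assms by (simp add: a_def)
  have "filterlim (\<lambda>n. 2 * a * real (Suc n)) at_top sequentially"
    by (rule filterlim_tendsto_pos_mult_at_top[OF tendsto_const _
          filterlim_compose[OF filterlim_real_sequentially filterlim_Suc]]) (use a in simp)
  then have "(\<lambda>n. (2 * a * real (Suc n)) ^ d / exp (2 * a * real (Suc n))) \<longlonglongrightarrow> 0"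
    by (rule filterlim_compose[OF tendsto_power_div_exp_0])
  then have lim: "(\<lambda>n. (2 * a * real (Suc n)) ^ d / exp (2 * a * real (Suc n)) / (2 * a) ^ d) \<longlonglongrightarrow> 0"
    by (rule tendsto_divide_zero)
  have "(\<lambda>n. (cmod (peak \<nu> q (real (Suc n)) w))\<^sup>2) \<longlonglongrightarrow> 0"
  proof (rule tendsto_sandwich[OF _ _ tendsto_const lim]; intro always_eventually allI)
    fix n
    define x where "x = real (Suc n)"
    have "a * x \<le> a * x\<^sup>2" using a by (simp add: x_def power2_eq_square)
    moreover have "- 2 * x\<^sup>2 * a = - 2 * (a * x\<^sup>2)" "- (2 * a * x) = - 2 * (a * x)" by simp_all
    ultimately have "- 2 * x\<^sup>2 * a \<le> - (2 * a * x)" by linarith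
    then have "x ^ d * exp (- 2 * x\<^sup>2 * a) \<le> x ^ d * exp (- (2 * a * x))"
      by (intro mult_left_mono) (auto simp: x_def)
    moreover have "(cmod (peak \<nu> q x w))\<^sup>2 = x ^ d * exp (- 2 * x\<^sup>2 * a)"
      unfolding a_def d_def by (rule norm_peak) (simp add: x_def)
    moreover have "(2 * a * x) ^ d / exp (2 * a * x) / (2 * a) ^ d = x ^ d * exp (- (2 * a * x))"
      using a by (simp add: power_mult_distrib exp_minus field_simps)
    ultimately show "(cmod (peak \<nu> q (real (Suc n)) w))\<^sup>2
        \<le> (2 * a * real (Suc n)) ^ d / exp (2 * a * real (Suc n)) / (2 * a) ^ d"
      unfolding x_def[symmetric] by simp
  qed auto
  then have "(\<lambda>n. sqrt ((cmod (peak \<nu> q (real (Suc n)) w))\<^sup>2)) \<longlonglongrightarrow> sqrt 0"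
    by (rule tendsto_real_sqrt)
  then show ?thesis by (simp add: tendsto_norm_zero_iff)
qed

section \<open>The Bergman space\<close>

lemma borel_measurable_cn_holomorphic:
  fixes f :: "complex^'n \<Rightarrow> complex"
  assumes "open \<Omega>" "cn_holomorphic_on f \<Omega>"
  shows "(\<lambda>z. indicator \<Omega> z *\<^sub>R (cmod (f z))\<^sup>2) \<in> borel_measurable borel"
  by (rule borel_measurable_continuous_on_indicator)
     (use assms in \<open>auto intro!: continuous_intros cn_holomorphic_on_imp_continuous_on\<close>)

lemma borel_measurable_nn_cn_holomorphic:
  fixes f :: "complex^'n \<Rightarrow> complex"
  assumes "open \<Omega>" "cn_holomorphic_on f \<Omega>"
  shows "(\<lambda>z. ennreal ((cmod (f z))\<^sup>2) * indicator \<Omega> z) \<in> borel_measurable lborel"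
proof -
  have "(\<lambda>z. ennreal ((cmod (f z))\<^sup>2) * indicator \<Omega> z) = (\<lambda>z. ennreal (indicator \<Omega> z *\<^sub>R (cmod (f z))\<^sup>2))"
    by (auto simp: indicator_def)
  then show ?thesis using borel_measurable_cn_holomorphic[OF assms] by simp
qed

text \<open>Membership in the space supplies integrability; otherwise \<open>bergman_norm\<close>
  takes the default value 0 of the Lebesgue integral.\<close>

lemma bergman_norm_eq_nn_integral:
  assumes "f \<in> bergman_space \<Omega>"
  shows "ennreal ((bergman_norm \<Omega> f)\<^sup>2) = (\<integral>\<^sup>+z\<in>\<Omega>. ennreal ((cmod (f z))\<^sup>2) \<partial>lborel)"
proof -
  have int: "integrable lborel (\<lambda>z. indicator \<Omega> z *\<^sub>R (cmod (f z))\<^sup>2)"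
    using assms by (simp add: bergman_space_def set_integrable_def)
  have "(bergman_norm \<Omega> f)\<^sup>2 = (\<integral>z. indicator \<Omega> z *\<^sub>R (cmod (f z))\<^sup>2 \<partial>lborel)"
    by (simp add: bergman_norm_def set_lebesgue_integral_def)
  also have "ennreal \<dots> = (\<integral>\<^sup>+z. ennreal (indicator \<Omega> z *\<^sub>R (cmod (f z))\<^sup>2) \<partial>lborel)"
    using int by (intro nn_integral_eq_integral[symmetric]) auto
  also have "\<dots> = (\<integral>\<^sup>+z\<in>\<Omega>. ennreal ((cmod (f z))\<^sup>2) \<partial>lborel)"
    by (intro nn_integral_cong) (auto simp: indicator_def)
  finally show ?thesis .
qed

lemma bergman_spaceI:
  assumes "open \<Omega>" and f: "cn_holomorphic_on f \<Omega>"
    and fin: "(\<integral>\<^sup>+z\<in>\<Omega>. ennreal ((cmod (f z))\<^sup>2) \<partial>lborel) < \<infinity>"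
  shows "f \<in> bergman_space \<Omega>"
proof -
  have "(\<integral>\<^sup>+z. ennreal (norm (indicator \<Omega> z *\<^sub>R (cmod (f z))\<^sup>2)) \<partial>lborel)
      = (\<integral>\<^sup>+z\<in>\<Omega>. ennreal ((cmod (f z))\<^sup>2) \<partial>lborel)"
    by (intro nn_integral_cong) (auto simp: indicator_def)
  then have "integrable lborel (\<lambda>z. indicator \<Omega> z *\<^sub>R (cmod (f z))\<^sup>2)"
    using borel_measurable_cn_holomorphic[OF assms(1,2)] fin
    by (intro integrableI_bounded) auto
  then show ?thesis using f by (simp add: bergman_space_def set_integrable_def)
qed

text \<open>The square of the difference is at most twice the sum of the two squares.\<close>

lemma bergman_space_diff:
  assumes \<Omega>: "open \<Omega>" and f: "f \<in> bergman_space \<Omega>" and g: "g \<in> bergman_space \<Omega>"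
  shows "(\<lambda>z. f z - g z) \<in> bergman_space \<Omega>"
proof (rule bergman_spaceI[OF \<Omega>])
  have hf: "cn_holomorphic_on f \<Omega>" and hg: "cn_holomorphic_on g \<Omega>"
    using f g by (auto simp: bergman_space_def)
  then show "cn_holomorphic_on (\<lambda>z. f z - g z) \<Omega>" by (rule cn_holomorphic_on_diff)
  note mf = borel_measurable_nn_cn_holomorphic[OF \<Omega> hf]
  note mg = borel_measurable_nn_cn_holomorphic[OF \<Omega> hg]
  have "(\<integral>\<^sup>+z\<in>\<Omega>. ennreal ((cmod (f z - g z))\<^sup>2) \<partial>lborel)
      \<le> (\<integral>\<^sup>+z. 2 * (ennreal ((cmod (f z))\<^sup>2) * indicator \<Omega> z) + 2 * (ennreal ((cmod (g z))\<^sup>2) * indicator \<Omega> z) \<partial>lborel)"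
  proof (rule nn_integral_mono)
    fix z
    have "(cmod (f z - g z))\<^sup>2 \<le> (cmod (f z) + cmod (g z))\<^sup>2"
      by (intro power_mono norm_triangle_ineq4) auto
    also have "\<dots> \<le> 2 * (cmod (f z))\<^sup>2 + 2 * (cmod (g z))\<^sup>2"
      using zero_le_power2[of "cmod (f z) - cmod (g z)"] by (simp add: power2_eq_square algebra_simps)
    finally have "ennreal ((cmod (f z - g z))\<^sup>2) \<le> ennreal (2 * (cmod (f z))\<^sup>2 + 2 * (cmod (g z))\<^sup>2)"
      by (rule ennreal_leI)
    also have "\<dots> = 2 * ennreal ((cmod (f z))\<^sup>2) + 2 * ennreal ((cmod (g z))\<^sup>2)"
      by (simp add: ennreal_mult)
    finally show "ennreal ((cmod (f z - g z))\<^sup>2) * indicator \<Omega> z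
        \<le> 2 * (ennreal ((cmod (f z))\<^sup>2) * indicator \<Omega> z) + 2 * (ennreal ((cmod (g z))\<^sup>2) * indicator \<Omega> z)"
      by (auto simp: indicator_def)
  qed
  also have "\<dots> = 2 * ennreal ((bergman_norm \<Omega> f)\<^sup>2) + 2 * ennreal ((bergman_norm \<Omega> g)\<^sup>2)"
    unfolding bergman_norm_eq_nn_integral[OF f] bergman_norm_eq_nn_integral[OF g]
    using mf mg by (simp add: nn_integral_add nn_integral_cmult)
  also have "\<dots> < \<infinity>" by (simp add: ennreal_mult_less_top)
  finally show "(\<integral>\<^sup>+z\<in>\<Omega>. ennreal ((cmod (f z - g z))\<^sup>2) \<partial>lborel) < \<infinity>" .
qed

text \<open>By Fatou's lemma the norm limit of the sequence vanishes almost everywhere.\<close>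

lemma bergman_norm_limit_pointwise_null:
  assumes \<Omega>: "open \<Omega>" and F: "\<And>n. F n \<in> bergman_space \<Omega>" and g: "g \<in> bergman_space \<Omega>"
    and lim: "(\<lambda>n. bergman_norm \<Omega> (\<lambda>z. F n z - g z)) \<longlonglongrightarrow> 0"
    and ptw: "\<And>z. z \<in> \<Omega> \<Longrightarrow> (\<lambda>n. F n z) \<longlonglongrightarrow> 0"
  shows "(\<lambda>n. \<integral>\<^sup>+z\<in>\<Omega>. ennreal ((cmod (F n z))\<^sup>2) \<partial>lborel) \<longlonglongrightarrow> 0"
proof -
  have dif: "(\<lambda>z. F n z - g z) \<in> bergman_space \<Omega>" for n by (rule bergman_space_diff[OF \<Omega> F g])
  have meas: "(\<lambda>z. ennreal ((cmod (f z))\<^sup>2) * indicator \<Omega> z) \<in> borel_measurable lborel"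
    if "f \<in> bergman_space \<Omega>" for f
    using that by (intro borel_measurable_nn_cn_holomorphic[OF \<Omega>]) (simp add: bergman_space_def)
  let ?I = "\<lambda>n. \<integral>\<^sup>+z\<in>\<Omega>. ennreal ((cmod (F n z - g z))\<^sup>2) \<partial>lborel"
  have "(\<lambda>n. (bergman_norm \<Omega> (\<lambda>z. F n z - g z))\<^sup>2) \<longlonglongrightarrow> 0"
    using tendsto_power[OF lim, of 2] by simp
  then have "(\<lambda>n. ennreal ((bergman_norm \<Omega> (\<lambda>z. F n z - g z))\<^sup>2)) \<longlonglongrightarrow> ennreal 0"
    by (rule tendsto_ennrealI)
  then have I: "?I \<longlonglongrightarrow> 0"
    by (simp add: bergman_norm_eq_nn_integral[OF dif])
  \<comment> \<open>As \<open>F n\<close> tends to 0 pointwise on \<Omega>, \<open>F n - g\<close>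
    tends to \<open>- g\<close> there.\<close>
  have "(\<integral>\<^sup>+z\<in>\<Omega>. ennreal ((cmod (g z))\<^sup>2) \<partial>lborel)
      = (\<integral>\<^sup>+z. liminf (\<lambda>n. ennreal ((cmod (F n z - g z))\<^sup>2) * indicator \<Omega> z) \<partial>lborel)"
  proof (rule nn_integral_cong)
    fix z
    have "(\<lambda>n. ennreal ((cmod (F n z - g z))\<^sup>2) * indicator \<Omega> z)
        \<longlonglongrightarrow> ennreal ((cmod (g z))\<^sup>2) * indicator \<Omega> z"
    proof (cases "z \<in> \<Omega>")
      case True
      have "(\<lambda>n. (cmod (F n z - g z))\<^sup>2) \<longlonglongrightarrow> (cmod (0 - g z))\<^sup>2"
        by (rule tendsto_power[OF tendsto_norm[OF tendsto_diff[OF ptw[OF True] tendsto_const]]])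
      then show ?thesis using True by (simp add: tendsto_ennrealI)
    qed simp
    then show "ennreal ((cmod (g z))\<^sup>2) * indicator \<Omega> z
        = liminf (\<lambda>n. ennreal ((cmod (F n z - g z))\<^sup>2) * indicator \<Omega> z)"
      by (rule lim_imp_Liminf[OF sequentially_bot, symmetric])
  qed
  also have "\<dots> \<le> liminf ?I" by (rule nn_integral_liminf) (rule meas[OF dif])
  also have "\<dots> = 0" using I by (rule lim_imp_Liminf[OF sequentially_bot])
  finally have ae: "AE z in lborel. ennreal ((cmod (g z))\<^sup>2) * indicator \<Omega> z = 0"
    using nn_integral_0_iff_AE[OF meas[OF g]] by simp
  have "(\<integral>\<^sup>+z\<in>\<Omega>. ennreal ((cmod (F n z))\<^sup>2) \<partial>lborel) = ?I n" for n
  proof (rule nn_integral_cong_AE)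
    show "AE z in lborel. ennreal ((cmod (F n z))\<^sup>2) * indicator \<Omega> z
        = ennreal ((cmod (F n z - g z))\<^sup>2) * indicator \<Omega> z"
      using ae by eventually_elim (auto simp: indicator_def split: if_splits)
  qed
  then show ?thesis using I by simp
qed

section \<open>Boundary contact contradicts compactness\<close>

lemma boundary_contact_not_compact:
  fixes \<Omega> :: "(complex^'n) set" and \<phi> :: "complex^'n \<Rightarrow> complex^'n"
  assumes \<Omega>: "smooth_bounded_strongly_convex_domain \<Omega>"
    and self: "\<phi> ` \<Omega> \<subseteq> \<Omega>"
    and U: "open U" "\<And>j. cn_holomorphic_on (\<lambda>z. \<phi> z $ j) U"
    and p: "p \<in> frontier \<Omega>" "p \<in> U" and q: "\<phi> p \<in> frontier \<Omega>"
  shows "\<not> compact_on_bergman_space \<Omega> (composition_operator \<phi>)"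
proof
  assume comp: "compact_on_bergman_space \<Omega> (composition_operator \<phi>)"
  let ?d = "DIM(complex^'n)"
  have op: "open \<Omega>" using \<Omega> by (simp add: smooth_bounded_strongly_convex_domain_def)
  \<comment> \<open>At \<open>\<phi> p\<close> the global support inequality is needed, at
    \<open>p\<close> the paraboloid inside \<Omega>.\<close>
  obtain \<nu> c where \<nu>: "norm \<nu> = 1" "c > 0"
    and supp: "\<And>w. w \<in> \<Omega> \<Longrightarrow> c * (norm (w - \<phi> p))\<^sup>2 \<le> \<nu> \<bullet> (w - \<phi> p)"
    by (rule strongly_convex_boundary_geometry[OF \<Omega> q]) blast
  obtain \<mu> M \<delta>1 where \<mu>: "norm \<mu> = 1" "M > 0" "\<delta>1 > 0"
    and inner: "\<And>z. norm (z - p) < \<delta>1 \<Longrightarrow> M * (norm (z - p))\<^sup>2 < \<mu> \<bullet> (z - p) \<Longrightarrow> z \<in> \<Omega>"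
    by (rule strongly_convex_boundary_geometry[OF \<Omega> p(1)]) blast
  define u where "u z = \<nu> \<bullet> (\<phi> z - \<phi> p)" for z
  have q_notin: "\<phi> p \<notin> \<Omega>" using q op by (simp add: frontier_def interior_open)
  have u_pos: "u z > 0" if "z \<in> \<Omega>" for z
  proof -
    have z: "\<phi> z \<in> \<Omega>" using self that by blast
    then have "\<phi> z \<noteq> \<phi> p" using q_notin by auto
    then have "0 < c * (norm (\<phi> z - \<phi> p))\<^sup>2" using \<nu> by simp
    then show ?thesis using supp[OF z] by (simp add: u_def)
  qed
  obtain D B \<delta>2 where D: "linear D" and B: "B > 0" "\<delta>2 > 0"
    and tay: "\<And>z. norm (z - p) < \<delta>2 \<Longrightarrow>
      cmod (hermitian_form \<nu> (\<phi> z - \<phi> p) - hermitian_form \<nu> (\<phi> p - \<phi> p) - D (z - p)) \<le> B * (norm (z - p))\<^sup>2"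
    by (rule cn_holomorphic_second_order_Taylor[OF cn_holomorphic_on_hermitian_form[OF U(2)] U(1) p(2)]) blast
  define L where "L v = Re (D v)" for v
  have L: "linear L"
    using D by (auto intro!: linearI simp: L_def linear_add linear_cmul)
  have uL: "\<bar>u z - L (z - p)\<bar> \<le> B * (norm (z - p))\<^sup>2" if "norm (z - p) < \<delta>2" for z
    using tay[OF that] abs_Re_le_cmod[of "hermitian_form \<nu> (\<phi> z - \<phi> p) - D (z - p)"]
    by (simp add: Re_hermitian_form u_def L_def)
  define \<delta> where "\<delta> = min \<delta>1 \<delta>2"
  have \<delta>: "\<delta> > 0" "\<delta> \<le> \<delta>1" "\<delta> \<le> \<delta>2" using \<mu> B by (auto simp: \<delta>_def)
  \<comment> \<open>If the differential \<open>L\<close> of \<open>u\<close> at \<open>p\<close>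
    were negative in an inward direction, \<open>u\<close> would be negative at
    \<open>p + s *\<^sub>R v\<close> for small \<open>s\<close>. The paraboloid puts these points in
    \<Omega>, where \<open>u\<close> is positive.\<close>
  have "L v \<ge> 0" if v: "\<mu> \<bullet> v > 0" for v
  proof (rule ccontr)
    assume "\<not> L v \<ge> 0"
    then have Lv: "L v < 0" by simp
    have vn: "norm v > 0" using v by auto
    have "\<forall>\<^sub>F s in at_right 0. s * norm v < \<delta>"
      by (rule order_tendstoD(2)[of _ 0]) (auto intro!: tendsto_eq_intros \<delta>)
    moreover have "\<forall>\<^sub>F s in at_right 0. M * s * (norm v)\<^sup>2 < \<mu> \<bullet> v"
      by (rule order_tendstoD(2)[of _ 0]) (auto intro!: tendsto_eq_intros v)
    moreover have "\<forall>\<^sub>F s in at_right 0. B * s * (norm v)\<^sup>2 < - L v"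
      by (rule order_tendstoD(2)[of _ 0]) (use Lv in \<open>auto intro!: tendsto_eq_intros\<close>)
    moreover have "\<forall>\<^sub>F s in at_right (0::real). s > 0" by (simp add: eventually_at_right_less)
    ultimately have "\<forall>\<^sub>F s in at_right 0. s > 0 \<and> s * norm v < \<delta> \<and>
        M * s * (norm v)\<^sup>2 < \<mu> \<bullet> v \<and> B * s * (norm v)\<^sup>2 < - L v"
      by eventually_elim simp
    then obtain s where s: "s > 0" "s * norm v < \<delta>"
      "M * s * (norm v)\<^sup>2 < \<mu> \<bullet> v" "B * s * (norm v)\<^sup>2 < - L v"
      by (metis (mono_tags, lifting) eventually_happens' trivial_limit_at_right_real)
    define z where "z = p + s *\<^sub>R v"
    have nz: "norm (z - p) = s * norm v" "\<mu> \<bullet> (z - p) = s * (\<mu> \<bullet> v)" "L (z - p) = s * L v"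
      using s L by (simp_all add: z_def linear_cmul)
    have sq: "(s * norm v)\<^sup>2 = s * (s * (norm v)\<^sup>2)" by (simp add: power2_eq_square)
    have "z \<in> \<Omega>"
    proof (rule inner)
      show "norm (z - p) < \<delta>1" using s nz \<delta> by simp
      have "s * (M * s * (norm v)\<^sup>2) < s * (\<mu> \<bullet> v)" using s by simp
      then show "M * (norm (z - p))\<^sup>2 < \<mu> \<bullet> (z - p)" unfolding nz sq by (simp add: mult_ac)
    qed
    then have "0 < u z" by (rule u_pos)
    moreover have "\<bar>u z - s * L v\<bar> \<le> B * (s * (s * (norm v)\<^sup>2))"
      using uL[of z] s nz \<delta> sq by simp
    moreover have "s * (B * s * (norm v)\<^sup>2) < s * (- L v)" using s by (intro mult_strict_left_mono)
    then have "B * (s * (s * (norm v)\<^sup>2)) < - (s * L v)" by (simp add: mult_ac)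
    ultimately show False by linarith
  qed
  note half = linear_nonneg_on_halfspace[OF L \<mu>(1) this]
  \<comment> \<open>The tangential part of the differential vanishes, so \<open>u\<close> is linear
    in the height and quadratic in the distance, which matches the shape of the caps.\<close>
  have u_le: "u z \<le> L \<mu> * (\<mu> \<bullet> (z - p)) + B * (norm (z - p))\<^sup>2" if "norm (z - p) < \<delta>" for z
    using uL[of z] half(2)[of "z - p"] that \<delta> by linarith
  obtain a X where a: "a > 0" and lower: "\<And>x. x \<ge> X \<Longrightarrow>
      ennreal a \<le> (\<integral>\<^sup>+z\<in>\<Omega>. ennreal (x ^ (?d + 1) * exp (- 2 * x\<^sup>2 * u z)) \<partial>lborel)"
    by (rule nn_integral_peak_ge[OF \<mu>(1,2) \<delta>(1) half(1), of B p \<Omega> u])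
       (use B inner \<delta> u_le in auto)
  obtain K where K: "K \<ge> 0" and upper: "\<And>x. x \<ge> 1 \<Longrightarrow>
      (\<integral>\<^sup>+w\<in>\<Omega>. ennreal (x ^ (?d + 1) * exp (- 2 * x\<^sup>2 * (\<nu> \<bullet> (w - \<phi> p)))) \<partial>lborel) \<le> ennreal K"
    by (rule nn_integral_peak_le[where \<Omega> = \<Omega>, OF \<nu> supp], assumption, rule that)
  \<comment> \<open>\<open>Suc n\<close> keeps the parameter at least 1, as \<open>upper\<close>
    requires.\<close>
  define F where "F n = peak \<nu> (\<phi> p) (real (Suc n))" for n
  have F_sq: "(cmod (F n w))\<^sup>2 = (real (Suc n)) ^ (?d + 1) * exp (- 2 * (real (Suc n))\<^sup>2 * (\<nu> \<bullet> (w - \<phi> p)))" for n w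
    unfolding F_def by (rule norm_peak) simp
  have F_int: "(\<integral>\<^sup>+w\<in>\<Omega>. ennreal ((cmod (F n w))\<^sup>2) \<partial>lborel) \<le> ennreal K" for n
    unfolding F_sq by (rule upper) simp
  have F_berg: "F n \<in> bergman_space \<Omega>" for n
  proof (rule bergman_spaceI[OF op])
    show "cn_holomorphic_on (F n) \<Omega>" unfolding F_def by (rule cn_holomorphic_on_peak)
    show "(\<integral>\<^sup>+w\<in>\<Omega>. ennreal ((cmod (F n w))\<^sup>2) \<partial>lborel) < \<infinity>"
      using F_int[of n] by (simp add: le_less_trans)
  qed
  have "\<bar>bergman_norm \<Omega> (F n)\<bar> \<le> sqrt K" for n
  proof -
    have "(bergman_norm \<Omega> (F n))\<^sup>2 \<le> K"
      using F_int[of n] K by (simp flip: bergman_norm_eq_nn_integral[OF F_berg])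
    then show ?thesis by (metis real_sqrt_abs real_sqrt_le_iff)
  qed
  then have bnd: "range F \<subseteq> bergman_space \<Omega> \<and> bounded (range (\<lambda>n. bergman_norm \<Omega> (F n)))"
    using F_berg by (auto intro!: boundedI[of _ "sqrt K"])
  obtain g r where g: "g \<in> bergman_space \<Omega>" and r: "strict_mono r"
    and lim: "(\<lambda>n. bergman_norm \<Omega> (\<lambda>z. composition_operator \<phi> (F (r n)) z - g z)) \<longlonglongrightarrow> 0"
    using comp[unfolded compact_on_bergman_space_def, THEN conjunct2, THEN spec, THEN mp, OF bnd]
    by blast
  have "(\<lambda>n. \<integral>\<^sup>+z\<in>\<Omega>. ennreal ((cmod (composition_operator \<phi> (F (r n)) z))\<^sup>2) \<partial>lborel) \<longlonglongrightarrow> 0"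
  proof (rule bergman_norm_limit_pointwise_null[OF op _ g lim])
    show "composition_operator \<phi> (F (r n)) \<in> bergman_space \<Omega>" for n
      using comp F_berg unfolding compact_on_bergman_space_def by blast
    fix z assume z: "z \<in> \<Omega>"
    have "(\<lambda>n. F n (\<phi> z)) \<longlonglongrightarrow> 0"
      unfolding F_def using u_pos[OF z] by (intro peak_tendsto_0) (simp add: u_def)
    then show "(\<lambda>n. composition_operator \<phi> (F (r n)) z) \<longlonglongrightarrow> 0"
      using LIMSEQ_subseq_LIMSEQ[OF _ r] by (fastforce simp: composition_operator_def o_def)
  qed
  then have "\<forall>\<^sub>F n in sequentially.
      (\<integral>\<^sup>+z\<in>\<Omega>. ennreal ((cmod (composition_operator \<phi> (F (r n)) z))\<^sup>2) \<partial>lborel) < ennreal a"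
    by (rule order_tendstoD(2)) (use a in simp)
  \<comment> \<open>A strictly increasing \<open>r\<close> satisfies \<open>n \<le> r n\<close>, so
    the lower bound holds along the subsequence.\<close>
  moreover have "\<forall>\<^sub>F n in sequentially. real (Suc (r n)) \<ge> X"
  proof -
    have "real (Suc (r n)) \<ge> X" if "n \<ge> nat \<lceil>X\<rceil>" for n
      using that seq_suble[OF r, of n] by linarith
    then show ?thesis using eventually_sequentially by blast
  qed
  ultimately have "\<forall>\<^sub>F n in sequentially. False"
  proof eventually_elim
    case (elim n)
    then show ?case using lower[of "real (Suc (r n))"]
      by (simp add: composition_operator_def F_sq u_def)
  qed
  then show False by simp
qed

section \<open>From boundary contact to the intersection of the two boundaries\<close>

theorem theorem2:
  fixes \<Omega> :: "(complex^'n) set" and \<phi> :: "complex^'n \<Rightarrow> complex^'n"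
  assumes "smooth_bounded_strongly_convex_domain \<Omega>"
    and "holomorphic_self_map \<Omega> \<phi>"
    and "\<forall>j. \<exists>U. open U \<and> closure \<Omega> \<subseteq> U \<and> cn_holomorphic_on (\<lambda>z. \<phi> z $ j) U"
    and "compact_on_bergman_space \<Omega> (composition_operator \<phi>)"
  shows "nowhere_dense_in (top_of_set (frontier \<Omega>)) (frontier \<Omega> \<inter> frontier (\<phi> ` closure \<Omega>))"
proof -
  have op: "open \<Omega>" and bd: "bounded \<Omega>"
    using assms(1) by (auto simp: smooth_bounded_strongly_convex_domain_def)
  have self: "\<phi> ` \<Omega> \<subseteq> \<Omega>" using assms(2) by (simp add: holomorphic_self_map_def)
  obtain V where V: "\<And>j. open (V j)" "\<And>j. closure \<Omega> \<subseteq> V j"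
    "\<And>j. cn_holomorphic_on (\<lambda>z. \<phi> z $ j) (V j)"
    using assms(3) by metis
  \<comment> \<open>Each component has its own neighbourhood; the index type is finite, so the
    intersection is open.\<close>
  define U where "U = (\<Inter>j. V j)"
  have U: "open U" "closure \<Omega> \<subseteq> U" using V(1,2) by (auto simp: U_def)
  have hol: "cn_holomorphic_on (\<lambda>z. \<phi> z $ j) U" for j
    using V(3) by (rule cn_holomorphic_on_subset) (auto simp: U_def)
  have "continuous_on (closure \<Omega>) (\<lambda>z. \<phi> z $ j)" for j
    using cn_holomorphic_on_imp_continuous_on[OF hol] U(2) continuous_on_subset by blast
  then have "continuous_on (closure \<Omega>) (\<lambda>z. \<chi> j. \<phi> z $ j)"
    by (intro continuous_on_vec_lambda)
  then have "continuous_on (closure \<Omega>) \<phi>" by simp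
  then have "compact (\<phi> ` closure \<Omega>)"
    using bd by (intro compact_continuous_image) auto
  \<comment> \<open>A compact image is closed, so each of its frontier points is a value of \<phi>
    on the closure.\<close>
  then have cl: "frontier (\<phi> ` closure \<Omega>) \<subseteq> \<phi> ` closure \<Omega>"
    by (simp add: compact_imp_closed frontier_subset_closed)
  have "frontier \<Omega> \<inter> frontier (\<phi> ` closure \<Omega>) = {}"
  proof (rule ccontr)
    assume "frontier \<Omega> \<inter> frontier (\<phi> ` closure \<Omega>) \<noteq> {}"
    then obtain p where p: "p \<in> closure \<Omega>" "\<phi> p \<in> frontier \<Omega>" using cl by blast
    \<comment> \<open>A preimage in \<Omega> would have its value in \<Omega>, which is open and so
      disjoint from its frontier.\<close>
    have "p \<in> frontier \<Omega>"
      using p self op by (auto simp: frontier_def interior_open)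
    then show False
      using boundary_contact_not_compact[OF assms(1) self U(1) hol _ _ p(2)] p(1) U(2) assms(4) by blast
  qed
  then show ?thesis by (simp add: nowhere_dense_in_def)
qed

end
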